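(* Let $(X,\tau)$ be an extended locally convex space with finest locally convex topology $\tau_F$ and weak topology $\tau_w$. If $\tau_w$ is metrizable, then $\tau_F=\tau_w$. The converse holds for countable extended locally convex spaces: if $(X,\tau)$ is a countable extended locally convex space and $\tau_F=\tau_w$, then $\tau_w$ is metrizable.
   Context: Vector spaces are over $\mathbb{K}$, where $\mathbb{K}$ is $\mathbb{R}$ or $\mathbb{C}$. An extended seminorm on $X$ is a map $\rho:X\to[0,\infty]$ with $\rho(\alpha x)=|\alpha|\rho(x)$ (convention $0\cdot\infty=0$) and $\rho(x+y)\le\rho(x)+\rho(y)$. An extended locally convex space (elcs) is a vector space $X$ with a group topology $\tau$ induced by a family $\{\rho_i\}_{i\in I}$ of extended seminorms, i.e. the sets $\{y:\rho_i(y-x)<\varepsilon \text{ for all } i\in J\}$ with $\varepsilon>0$ and $J\subseteq I$ finite form a neighborhood base at $x$. It is a countable elcs if $\tau$ is induced by a countable family of extended seminorms. $X^*$ is the set of all $\tau$-continuous linear functionals $X\to\mathbb{K}$. The finest locally convex topology (flc topology) $\tau_F$ of $(X,\tau)$ is the finest locally convex topology on $X$ (i.e. one induced by finite-valued seminorms) that is coarser than $\tau$. The weak topology $\tau_w$ on $X$ is induced by the seminorms $x\mapsto|f(x)|$, $f\in X^*$.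
   Formalization: In the converse, τ is additionally assumed to be Hausdorff; without this it fails (a nonzero space with the zero seminorm has τ_F = τ_w indiscrete, not metrizable), and metrizability of τ_w forces τ to be Hausdorff. *)

theory Defs
  imports "HOL-Analysis.Analysis"
begin

text \<open>
  A vector space is the universe of a type \<open>'v\<close> with a scalar multiplication
  \<open>smul :: 'k \<Rightarrow> 'v \<Rightarrow> 'v\<close> satisfying the library's \<^locale>\<open>vector_space\<close>. The scalars
  \<open>'k\<close> are kept generic; the sort \<open>{real_normed_field, euclidean_space}\<close> has \<open>real\<close> and
  \<open>complex\<close> as instances and, by Frobenius' theorem, no others up to isomorphism.
\<close>

text \<open>Multiplication on \<^typ>\<open>ennreal\<close> satisfies the convention \<open>0 * \<infinity> = 0\<close>.\<close>

definition extended_seminorm ::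
    "('k::real_normed_field \<Rightarrow> 'v::ab_group_add \<Rightarrow> 'v) \<Rightarrow> ('v \<Rightarrow> ennreal) \<Rightarrow> bool" where
  "extended_seminorm smul \<rho> \<longleftrightarrow>
     (\<forall>a x. \<rho> (smul a x) = ennreal (norm a) * \<rho> x) \<and>
     (\<forall>x y. \<rho> (x + y) \<le> \<rho> x + \<rho> y)"

definition finite_seminorm ::
    "('k::real_normed_field \<Rightarrow> 'v::ab_group_add \<Rightarrow> 'v) \<Rightarrow> ('v \<Rightarrow> ennreal) \<Rightarrow> bool" where
  "finite_seminorm smul \<rho> \<longleftrightarrow> extended_seminorm smul \<rho> \<and> (\<forall>x. \<rho> x < \<infinity>)"

definition basic_nbhd :: "('v::ab_group_add \<Rightarrow> ennreal) set \<Rightarrow> real \<Rightarrow> 'v \<Rightarrow> 'v set" where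
  "basic_nbhd J \<epsilon> x = {y. \<forall>\<rho>\<in>J. \<rho> (y - x) < ennreal \<epsilon>}"

text \<open>
  A family of extended seminorms is represented by its set of members. For extended seminorms
  the basic neighbourhoods are open (lemma \<open>openin_basic_nbhd\<close> below), so that they form a
  neighbourhood base at each point.
\<close>

definition induced_topology :: "('v::ab_group_add \<Rightarrow> ennreal) set \<Rightarrow> 'v topology" where
  "induced_topology P = topology (\<lambda>U. \<forall>x\<in>U. \<exists>J \<epsilon>. finite J \<and> J \<subseteq> P \<and> \<epsilon> > 0 \<and> basic_nbhd J \<epsilon> x \<subseteq> U)"

lemma openin_induced_topology:
  "openin (induced_topology P) U \<longleftrightarrow>
     (\<forall>x\<in>U. \<exists>J \<epsilon>. finite J \<and> J \<subseteq> P \<and> \<epsilon> > 0 \<and> basic_nbhd J \<epsilon> x \<subseteq> U)"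
proof -
  let ?op = "\<lambda>U. \<forall>x\<in>U. \<exists>J \<epsilon>. finite J \<and> J \<subseteq> P \<and> \<epsilon> > 0 \<and> basic_nbhd J \<epsilon> x \<subseteq> U"
  have "istopology ?op"
    unfolding istopology_def
  proof (intro conjI allI impI)
    fix S T assume S: "?op S" and T: "?op T"
    show "?op (S \<inter> T)"
    proof
      fix x assume x: "x \<in> S \<inter> T"
      obtain J e where J: "finite J" "J \<subseteq> P" "e > 0" "basic_nbhd J e x \<subseteq> S"
        using bspec[OF S, of x] x by blast
      obtain K d where K: "finite K" "K \<subseteq> P" "d > 0" "basic_nbhd K d x \<subseteq> T"
        using bspec[OF T, of x] x by blast
      have "basic_nbhd (J \<union> K) (min e d) x \<subseteq> basic_nbhd J e x \<inter> basic_nbhd K d x"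
      proof
        fix y assume y: "y \<in> basic_nbhd (J \<union> K) (min e d) x"
        have le: "ennreal (min e d) \<le> ennreal e" "ennreal (min e d) \<le> ennreal d"
          by (simp_all add: ennreal_leI)
        have lt: "\<rho> (y - x) < ennreal (min e d)" if "\<rho> \<in> J \<union> K" for \<rho>
          using y that unfolding basic_nbhd_def by blast
        show "y \<in> basic_nbhd J e x \<inter> basic_nbhd K d x"
          unfolding basic_nbhd_def using less_le_trans[OF lt le(1)] less_le_trans[OF lt le(2)] by blast
      qed
      then have "basic_nbhd (J \<union> K) (min e d) x \<subseteq> S \<inter> T"
        using J(4) K(4) by blast
      then show "\<exists>J \<epsilon>. finite J \<and> J \<subseteq> P \<and> \<epsilon> > 0 \<and> basic_nbhd J \<epsilon> x \<subseteq> S \<inter> T"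
        using J(1-3) K(1-3) by (intro exI[of _ "J \<union> K"] exI[of _ "min e d"] conjI) simp_all
    qed
  next
    fix \<K> assume \<K>: "\<forall>K\<in>\<K>. ?op K"
    show "?op (\<Union>\<K>)"
    proof
      fix x assume "x \<in> \<Union>\<K>"
      then obtain K where K: "K \<in> \<K>" "x \<in> K" by blast
      then obtain J e where "finite J" "J \<subseteq> P" "e > 0" "basic_nbhd J e x \<subseteq> K"
        using bspec[OF bspec[OF \<K> K(1)] K(2)] by blast
      then show "\<exists>J \<epsilon>. finite J \<and> J \<subseteq> P \<and> \<epsilon> > 0 \<and> basic_nbhd J \<epsilon> x \<subseteq> \<Union>\<K>"
        using K(1) by (intro exI[of _ J] exI[of _ e]) blast
    qed
  qed
  then show ?thesis by (simp add: induced_topology_def topology_inverse')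
qed

lemma topspace_induced_topology [simp]: "topspace (induced_topology P) = UNIV"
proof -
  have "openin (induced_topology P) UNIV"
    unfolding openin_induced_topology by (auto intro!: exI[of _ "{}"] exI[of _ 1])
  then show ?thesis using openin_subset by blast
qed

lemma extended_seminorm_zero:
  fixes smul :: "'k::real_normed_field \<Rightarrow> 'v::ab_group_add \<Rightarrow> 'v"
  assumes "vector_space smul" "extended_seminorm smul \<rho>"
  shows "\<rho> 0 = 0"
proof -
  interpret vector_space smul by fact
  have "\<rho> (smul 0 0) = ennreal (norm (0::'k)) * \<rho> 0"
    using assms(2) unfolding extended_seminorm_def by blast
  then show ?thesis by simp
qed

lemma openin_basic_nbhd:
  assumes J: "finite J" "J \<subseteq> P" and sn: "\<And>\<rho>. \<rho> \<in> J \<Longrightarrow> extended_seminorm smul \<rho>"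
  shows "openin (induced_topology P) (basic_nbhd J \<epsilon> x)"
  unfolding openin_induced_topology
proof
  fix y assume y: "y \<in> basic_nbhd J \<epsilon> x"
  have "\<exists>d>0. \<forall>z. \<rho> (z - y) < ennreal d \<longrightarrow> \<rho> (z - x) < ennreal \<epsilon>" if "\<rho> \<in> J" for \<rho>
  proof -
    have lt: "\<rho> (y - x) < ennreal \<epsilon>" using y that by (auto simp: basic_nbhd_def)
    then obtain r where r: "\<rho> (y - x) = ennreal r" "r \<ge> 0" by (cases "\<rho> (y - x)") auto
    have re: "r < \<epsilon>" using lt r by (simp add: ennreal_less_iff)
    have "\<rho> (z - x) < ennreal \<epsilon>" if z: "\<rho> (z - y) < ennreal (\<epsilon> - r)" for z
    proof -
      have "\<rho> (z - x) = \<rho> ((z - y) + (y - x))" by simp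
      also have "\<dots> \<le> \<rho> (z - y) + \<rho> (y - x)"
        using sn[OF \<open>\<rho> \<in> J\<close>] unfolding extended_seminorm_def by blast
      also have "\<dots> < ennreal (\<epsilon> - r) + ennreal r"
        using z r by (simp add: add.commute ennreal_add_left_cancel_less)
      also have "\<dots> = ennreal \<epsilon>" using r(2) re by (simp flip: ennreal_plus)
      finally show ?thesis .
    qed
    then show ?thesis using re by (intro exI[of _ "\<epsilon> - r"]) auto
  qed
  then obtain d where d: "\<And>\<rho>. \<rho> \<in> J \<Longrightarrow> d \<rho> > 0"
    "\<And>\<rho> z. \<rho> \<in> J \<Longrightarrow> \<rho> (z - y) < ennreal (d \<rho>) \<Longrightarrow> \<rho> (z - x) < ennreal \<epsilon>"
    by metis
  define e where "e = Min (insert 1 (d ` J))"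
  have e: "e > 0" "\<And>\<rho>. \<rho> \<in> J \<Longrightarrow> e \<le> d \<rho>" using J(1) d(1) by (auto simp: e_def)
  have "basic_nbhd J e y \<subseteq> basic_nbhd J \<epsilon> x"
  proof
    fix z assume z: "z \<in> basic_nbhd J e y"
    have "\<rho> (z - x) < ennreal \<epsilon>" if "\<rho> \<in> J" for \<rho>
    proof (rule d(2)[OF that])
      have "\<rho> (z - y) < ennreal e" using z that unfolding basic_nbhd_def by blast
      also have "\<dots> \<le> ennreal (d \<rho>)" by (rule ennreal_leI[OF e(2)[OF that]])
      finally show "\<rho> (z - y) < ennreal (d \<rho>)" .
    qed
    then show "z \<in> basic_nbhd J \<epsilon> x" unfolding basic_nbhd_def by blast
  qed
  then show "\<exists>K \<delta>. finite K \<and> K \<subseteq> P \<and> \<delta> > 0 \<and> basic_nbhd K \<delta> y \<subseteq> basic_nbhd J \<epsilon> x"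
    using J e(1) by blast
qed

text \<open>A topology of the following kind is automatically a group topology on \<open>(X, +)\<close>.\<close>

definition elcs ::
    "('k::real_normed_field \<Rightarrow> 'v::ab_group_add \<Rightarrow> 'v) \<Rightarrow> 'v topology \<Rightarrow> bool" where
  "elcs smul \<tau> \<longleftrightarrow> vector_space smul \<and>
     (\<exists>P. (\<forall>\<rho>\<in>P. extended_seminorm smul \<rho>) \<and> \<tau> = induced_topology P)"

definition countable_elcs ::
    "('k::real_normed_field \<Rightarrow> 'v::ab_group_add \<Rightarrow> 'v) \<Rightarrow> 'v topology \<Rightarrow> bool" where
  "countable_elcs smul \<tau> \<longleftrightarrow> vector_space smul \<and>
     (\<exists>P. countable P \<and> (\<forall>\<rho>\<in>P. extended_seminorm smul \<rho>) \<and> \<tau> = induced_topology P)"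

definition locally_convex_topology ::
    "('k::real_normed_field \<Rightarrow> 'v::ab_group_add \<Rightarrow> 'v) \<Rightarrow> 'v topology \<Rightarrow> bool" where
  "locally_convex_topology smul \<sigma> \<longleftrightarrow> vector_space smul \<and>
     (\<exists>P. (\<forall>\<rho>\<in>P. finite_seminorm smul \<rho>) \<and> \<sigma> = induced_topology P)"

definition coarser :: "'v topology \<Rightarrow> 'v topology \<Rightarrow> bool" where
  "coarser \<sigma> \<tau> \<longleftrightarrow> (\<forall>U. openin \<sigma> U \<longrightarrow> openin \<tau> U)"

definition continuous_dual ::
    "('k::real_normed_field \<Rightarrow> 'v::ab_group_add \<Rightarrow> 'v) \<Rightarrow> 'v topology \<Rightarrow> ('v \<Rightarrow> 'k) set" where
  "continuous_dual smul \<tau> =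
     {f. Vector_Spaces.linear smul (*) f \<and> continuous_map \<tau> euclidean f}"

definition weak_topology ::
    "('k::real_normed_field \<Rightarrow> 'v::ab_group_add \<Rightarrow> 'v) \<Rightarrow> 'v topology \<Rightarrow> 'v topology" where
  "weak_topology smul \<tau> =
     induced_topology ((\<lambda>f x. ennreal (norm (f x))) ` continuous_dual smul \<tau>)"

definition is_flc_topology ::
    "('k::real_normed_field \<Rightarrow> 'v::ab_group_add \<Rightarrow> 'v) \<Rightarrow> 'v topology \<Rightarrow> 'v topology \<Rightarrow> bool" where
  "is_flc_topology smul \<tau> \<sigma> \<longleftrightarrow>
     locally_convex_topology smul \<sigma> \<and> coarser \<sigma> \<tau> \<and>
     (\<forall>\<sigma>'. locally_convex_topology smul \<sigma>' \<and> coarser \<sigma>' \<tau> \<longrightarrow> coarser \<sigma>' \<sigma>)"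

definition flc_topology ::
    "('k::real_normed_field \<Rightarrow> 'v::ab_group_add \<Rightarrow> 'v) \<Rightarrow> 'v topology \<Rightarrow> 'v topology" where
  "flc_topology smul \<tau> = (THE \<sigma>. is_flc_topology smul \<tau> \<sigma>)"

lemma is_flc_topology_unique:
  "is_flc_topology smul \<tau> \<sigma> \<Longrightarrow> is_flc_topology smul \<tau> \<sigma>' \<Longrightarrow> \<sigma> = \<sigma>'"
  unfolding is_flc_topology_def coarser_def topology_eq by blast

lemma is_flc_topology_exists:
  assumes "elcs smul \<tau>"
  shows "\<exists>\<sigma>. is_flc_topology smul \<tau> \<sigma>"
proof -
  have vs: "vector_space smul" and top: "topspace \<tau> = UNIV"
    using assms by (auto simp: elcs_def)
  define Q where
    "Q = \<Union>{P. (\<forall>\<rho>\<in>P. finite_seminorm smul \<rho>) \<and> coarser (induced_topology P) \<tau>}"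
  have Qsn: "finite_seminorm smul \<rho>" if "\<rho> \<in> Q" for \<rho>
    using that by (auto simp: Q_def)
  have ball: "openin \<tau> (basic_nbhd {\<rho>} e x)" if \<rho>: "\<rho> \<in> Q" for \<rho> e x
  proof -
    obtain P where P: "\<rho> \<in> P" "coarser (induced_topology P) \<tau>"
      using \<rho> by (auto simp: Q_def)
    have "openin (induced_topology P) (basic_nbhd {\<rho>} e x)"
      using P(1) Qsn[OF \<rho>] by (intro openin_basic_nbhd) (auto simp: finite_seminorm_def)
    then show ?thesis using P(2) by (simp add: coarser_def)
  qed
  have "openin \<tau> U" if U: "openin (induced_topology Q) U" for U
  proof (subst openin_subopen, rule ballI)
    fix x assume x: "x \<in> U"
    obtain J e where J: "finite J" "J \<subseteq> Q" "e > 0" "basic_nbhd J e x \<subseteq> U"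
      using bspec[OF U[unfolded openin_induced_topology] x] by blast
    have eq: "basic_nbhd J e x = (\<Inter>\<rho>\<in>J. basic_nbhd {\<rho>} e x) \<inter> topspace \<tau>"
      using top by (auto simp: basic_nbhd_def)
    have "openin \<tau> (basic_nbhd J e x)"
    proof (cases "J = {}")
      case True
      then show ?thesis using eq by simp
    next
      case False
      then show ?thesis unfolding eq
        using J ball by (intro openin_Int openin_INT2 openin_topspace) auto
    qed
    moreover have "x \<in> basic_nbhd J e x"
      using extended_seminorm_zero[OF vs] Qsn J(2,3)
      by (fastforce simp: basic_nbhd_def finite_seminorm_def)
    ultimately show "\<exists>T. openin \<tau> T \<and> x \<in> T \<and> T \<subseteq> U" using J(4) by blast
  qed
  moreover have "coarser (induced_topology P) (induced_topology Q)"
    if "\<forall>\<rho>\<in>P. finite_seminorm smul \<rho>" "coarser (induced_topology P) \<tau>" for P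
  proof -
    have "P \<subseteq> Q" using that by (auto simp: Q_def)
    then show ?thesis
      unfolding coarser_def openin_induced_topology by (meson subset_trans)
  qed
  moreover have "locally_convex_topology smul (induced_topology Q)"
    unfolding locally_convex_topology_def using vs Qsn by blast
  ultimately have "is_flc_topology smul \<tau> (induced_topology Q)"
    unfolding is_flc_topology_def locally_convex_topology_def coarser_def by blast
  then show ?thesis ..
qed

lemma is_flc_topology_flc_topology:
  "elcs smul \<tau> \<Longrightarrow> is_flc_topology smul \<tau> (flc_topology smul \<tau>)"
  unfolding flc_topology_def
  by (metis is_flc_topology_exists is_flc_topology_unique theI)

end

theory Submission
  imports Defs
begin

text \<open>
  Write \<open>X\<^sup>*\<close> for the continuous dual of \<open>(X, \<tau>)\<close>. The weak topology is locally convex and coarser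
  than \<open>\<tau>\<close>, hence coarser than the finest locally convex topology \<open>\<tau>\<^sub>F\<close>. Both implications are about
  seminorms that vanish on a \<^emph>\<open>common kernel\<close>, the set where all functionals of a finite set
  \<open>F \<subseteq> X\<^sup>*\<close> vanish. By linear algebra such a seminorm is at most \<open>C * (\<Sum>f\<in>F. norm (f x))\<close>
  (\<open>seminorm_le_sum_functionals\<close>), so it is weakly continuous; and a weakly continuous seminorm
  vanishes on some common kernel, because a seminorm that is bounded on a subspace is zero there.
  So \<open>\<tau>\<^sub>F\<close> equals the weak topology exactly if every \<open>\<tau>\<close>-continuous finite seminorm vanishes on a
  common kernel.

  Suppose that the weak topology is metrizable. A countable neighbourhood base at \<open>0\<close> yields finite
  sets \<open>F n \<subseteq> X\<^sup>*\<close> such that each \<open>f \<in> X\<^sup>*\<close> vanishes on the common kernel of some \<open>F n\<close>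
  (\<open>common_kernels_cofinal_if_metrizable\<close>). If a \<open>\<tau>\<close>-continuous seminorm \<open>p\<close> vanished on none of
  these kernels, there would be a point \<open>x n\<close> in the \<open>n\<close>-th one with \<open>p (x n) > 0\<close>, for every \<open>n\<close>.
  Now there is a single functional \<open>f\<close> with \<open>norm (f y) \<le> 2 * p y\<close> that is nonzero at all \<open>x n\<close>
  (\<open>functional_nonzero_on_sequence\<close>): it is the limit of a series of Hahn-Banach functionals with
  geometrically decreasing coefficients. This \<open>f\<close> is continuous and vanishes on none of the common
  kernels, a contradiction.

  Suppose conversely that \<open>\<tau>\<close> is induced by a countable set \<open>P\<close> of extended seminorms and that \<open>\<tau>\<^sub>F\<close>
  is the weak topology. The supremum \<open>\<sigma>\<close> of a finite \<open>J \<subseteq> P\<close> may take the value \<open>\<infinity>\<close>, but there is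
  a finite seminorm \<open>q \<le> \<sigma>\<close> with the same zeros (\<open>finite_seminorm_below_with_same_zeros\<close>): project
  onto \<open>{x. \<sigma> x < \<infinity>}\<close>, apply \<open>\<sigma>\<close>, and add a norm of the other component. As \<open>q\<close> is \<open>\<tau>\<close>-continuous,
  it is weakly continuous by assumption, so it and all members of \<open>J\<close> vanish on the common kernel of
  a finite \<open>F J \<subseteq> X\<^sup>*\<close>. Let \<open>G\<close> be the countable union of the sets \<open>F J\<close>. Each continuous functional
  vanishes where all members of some finite \<open>J\<close> vanish, so it is controlled by finitely many elements
  of \<open>G\<close>; thus \<open>G\<close> induces the weak topology. Since \<open>\<tau>\<close> is Hausdorff, \<open>G\<close> separates points, and
  evaluation at the elements of \<open>G\<close> embeds \<open>X\<close> in a countable product of copies of the scalar field.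
\<close>

section \<open>Neighbourhoods in topologies induced by extended seminorms\<close>

lemma mem_basic_nbhd_translate: "y \<in> basic_nbhd J \<epsilon> x \<longleftrightarrow> y - x \<in> basic_nbhd J \<epsilon> 0"
  by (simp add: basic_nbhd_def)

lemma basic_nbhd_mono:
  assumes "J \<subseteq> K" "\<delta> \<le> \<epsilon>" shows "basic_nbhd K \<delta> x \<subseteq> basic_nbhd J \<epsilon> x"
proof -
  have "ennreal \<delta> \<le> ennreal \<epsilon>" using assms(2) by (rule ennreal_leI)
  then show ?thesis using assms(1) unfolding basic_nbhd_def by (blast intro: less_le_trans)
qed

lemma basic_nbhd_in_openin:
  assumes "openin (induced_topology P) U" "x \<in> U"
  obtains J \<delta> where "finite J" "J \<subseteq> P" "\<delta> > 0" "basic_nbhd J \<delta> x \<subseteq> U"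
  using bspec[OF assms(1)[unfolded openin_induced_topology] assms(2)] by blast

text \<open>
  Translations carry basic neighbourhoods of \<open>0\<close> to basic neighbourhoods of any other point, and
  finite intersections reduce to a single seminorm; so only balls of one seminorm around \<open>0\<close>
  have to be compared.
\<close>

lemma coarser_induced_topologyI:
  assumes sub: "\<And>\<rho> \<epsilon>. \<rho> \<in> P \<Longrightarrow> \<epsilon> > 0 \<Longrightarrow>
    \<exists>J \<delta>. finite J \<and> J \<subseteq> Q \<and> \<delta> > 0 \<and> basic_nbhd J \<delta> 0 \<subseteq> basic_nbhd {\<rho>} \<epsilon> 0"
  shows "coarser (induced_topology P) (induced_topology Q)"
proof -
  have *: "\<exists>K \<delta>. finite K \<and> K \<subseteq> Q \<and> \<delta> > 0 \<and> basic_nbhd K \<delta> 0 \<subseteq> basic_nbhd J \<epsilon> 0"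
    if "finite J" "J \<subseteq> P" "\<epsilon> > 0" for J \<epsilon>
    using that
  proof (induction J rule: finite_induct)
    case empty
    then show ?case by (intro exI[of _ "{}"] exI[of _ 1]) (simp add: basic_nbhd_def)
  next
    case (insert \<rho> J)
    obtain K \<delta> where K: "finite K" "K \<subseteq> Q" "\<delta> > 0" "basic_nbhd K \<delta> 0 \<subseteq> basic_nbhd J \<epsilon> 0"
      using insert by auto
    obtain L \<eta> where L: "finite L" "L \<subseteq> Q" "\<eta> > 0" "basic_nbhd L \<eta> 0 \<subseteq> basic_nbhd {\<rho>} \<epsilon> 0"
      using sub[of \<rho> \<epsilon>] insert.prems by blast
    have "basic_nbhd (K \<union> L) (min \<delta> \<eta>) 0 \<subseteq> basic_nbhd K \<delta> 0"
      "basic_nbhd (K \<union> L) (min \<delta> \<eta>) 0 \<subseteq> basic_nbhd L \<eta> 0"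
      by (intro basic_nbhd_mono; simp)+
    moreover have "basic_nbhd (insert \<rho> J) \<epsilon> 0 = basic_nbhd {\<rho>} \<epsilon> 0 \<inter> basic_nbhd J \<epsilon> 0"
      by (auto simp: basic_nbhd_def)
    ultimately have "basic_nbhd (K \<union> L) (min \<delta> \<eta>) 0 \<subseteq> basic_nbhd (insert \<rho> J) \<epsilon> 0"
      using K(4) L(4) by blast
    moreover have "finite (K \<union> L)" "K \<union> L \<subseteq> Q" "min \<delta> \<eta> > 0" using K(1-3) L(1-3) by simp_all
    ultimately show ?case by (intro exI[of _ "K \<union> L"] exI[of _ "min \<delta> \<eta>"] conjI)
  qed
  show ?thesis
    unfolding coarser_def openin_induced_topology
  proof (intro allI impI ballI)
    fix U x
    assume U: "\<forall>x\<in>U. \<exists>J \<epsilon>. finite J \<and> J \<subseteq> P \<and> 0 < \<epsilon> \<and> basic_nbhd J \<epsilon> x \<subseteq> U" "x \<in> U"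
    obtain J \<epsilon> where J: "finite J" "J \<subseteq> P" "\<epsilon> > 0" "basic_nbhd J \<epsilon> x \<subseteq> U"
      using bspec[OF U] by blast
    obtain K \<delta> where K: "finite K" "K \<subseteq> Q" "\<delta> > 0" "basic_nbhd K \<delta> 0 \<subseteq> basic_nbhd J \<epsilon> 0"
      using *[OF J(1-3)] by blast
    have "basic_nbhd K \<delta> x \<subseteq> basic_nbhd J \<epsilon> x"
      using K(4) mem_basic_nbhd_translate[of _ _ _ x] by blast
    then show "\<exists>J \<epsilon>. finite J \<and> J \<subseteq> Q \<and> 0 < \<epsilon> \<and> basic_nbhd J \<epsilon> x \<subseteq> U"
      using J(4) K(1-3) by (intro exI[of _ K] exI[of _ \<delta>]) simp
  qed
qed

lemma coarser_antisym: "coarser \<sigma> \<tau> \<Longrightarrow> coarser \<tau> \<sigma> \<Longrightarrow> \<sigma> = \<tau>"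
  unfolding coarser_def topology_eq by blast

lemma coarser_basic_nbhd:
  assumes "vector_space smul" "extended_seminorm smul \<rho>" "\<rho> \<in> P" "\<epsilon> > 0"
    and "coarser (induced_topology P) (induced_topology Q)"
  obtains J \<delta> where "finite J" "J \<subseteq> Q" "\<delta> > 0" "basic_nbhd J \<delta> 0 \<subseteq> basic_nbhd {\<rho>} \<epsilon> 0"
proof -
  have "openin (induced_topology P) (basic_nbhd {\<rho>} \<epsilon> 0)"
    using assms by (intro openin_basic_nbhd) auto
  then have "openin (induced_topology Q) (basic_nbhd {\<rho>} \<epsilon> 0)"
    using assms(5) by (simp add: coarser_def)
  moreover have "0 \<in> basic_nbhd {\<rho>} \<epsilon> 0"
    using assms by (simp add: basic_nbhd_def extended_seminorm_zero[OF assms(1,2)])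
  ultimately show thesis
    using that basic_nbhd_in_openin by blast
qed

abbreviation modulus :: "('v \<Rightarrow> 'k::real_normed_field) \<Rightarrow> 'v \<Rightarrow> ennreal" where
  "modulus f \<equiv> \<lambda>x. ennreal (norm (f x))"

definition common_kernel :: "('v \<Rightarrow> 'k::zero) set \<Rightarrow> 'v set" where
  "common_kernel F = {x. \<forall>f\<in>F. f x = 0}"

lemma common_kernel_subset_basic_nbhd:
  "\<delta> > 0 \<Longrightarrow> common_kernel F \<subseteq> basic_nbhd (modulus ` F) \<delta> 0"
  by (auto simp: common_kernel_def basic_nbhd_def)

text \<open>
  Evaluation at the elements of \<open>G\<close> is injective because \<open>G\<close> separates points, and the
  neighbourhoods of the induced topology are the traces of the product topology; so the space is
  homeomorphic to a subspace of a countable product of copies of the field.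
\<close>

lemma metrizable_induced_topology_modulus:
  fixes G :: "('v::ab_group_add \<Rightarrow> 'k::real_normed_field) set"
  assumes G: "countable G" and diff: "\<And>g x y. g \<in> G \<Longrightarrow> g (x - y) = g x - g y"
    and sep: "\<And>x. x \<noteq> 0 \<Longrightarrow> \<exists>g\<in>G. g x \<noteq> 0"
  shows "metrizable_space (induced_topology (modulus ` G))"
proof -
  let ?X = "induced_topology (modulus ` G)"
  let ?Y = "product_topology (\<lambda>_. euclidean :: 'k topology) G"
  define \<Phi> where "\<Phi> x = restrict (\<lambda>g. g x) G" for x
  let ?R = "subtopology ?Y (range \<Phi>)"
  have top: "\<Phi> x \<in> topspace ?Y" for x by (simp add: \<Phi>_def)
  then have topR: "topspace ?R = range \<Phi>" by (auto simp: topspace_subtopology)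
  have coord: "continuous_map ?X euclidean g" if g: "g \<in> G" for g
  proof -
    have "openin ?X {x. g x \<in> U}" if U: "open U" for U
      unfolding openin_induced_topology
    proof safe
      fix x assume "g x \<in> U"
      then obtain e where e: "e > 0" "ball (g x) e \<subseteq> U" using U openE by blast
      have "basic_nbhd {modulus g} e x \<subseteq> {x. g x \<in> U}"
      proof
        fix y assume "y \<in> basic_nbhd {modulus g} e x"
        then have "norm (g y - g x) < e"
          using e(1) by (simp add: basic_nbhd_def ennreal_less_iff diff[OF g])
        then show "y \<in> {x. g x \<in> U}" using e(2) by (auto simp: dist_norm norm_minus_commute)
      qed
      then show "\<exists>J \<epsilon>. finite J \<and> J \<subseteq> modulus ` G \<and> \<epsilon> > 0 \<and> basic_nbhd J \<epsilon> x \<subseteq> {x. g x \<in> U}"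
        using e(1) g by (intro exI[of _ "{modulus g}"] exI[of _ e]) simp
    qed
    then show ?thesis by (simp add: continuous_map_def)
  qed
  have "continuous_map ?X ?Y \<Phi>"
    unfolding continuous_map_componentwise
  proof (intro conjI ballI)
    fix g assume g: "g \<in> G"
    then have "(\<lambda>x. \<Phi> x g) = g" by (auto simp: \<Phi>_def)
    then show "continuous_map ?X euclidean (\<lambda>x. \<Phi> x g)" using coord[OF g] by simp
  qed (auto simp: \<Phi>_def)
  then have cont: "continuous_map ?X ?R \<Phi>" by (simp add: continuous_map_in_subtopology)
  have open_map: "open_map ?X ?R \<Phi>"
    unfolding open_map_def
  proof (intro allI impI)
    fix U assume U: "openin ?X U"
    show "openin ?R (\<Phi> ` U)"
    proof (subst openin_subopen, rule ballI)
      fix z assume "z \<in> \<Phi> ` U"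
      then obtain x where x: "x \<in> U" "z = \<Phi> x" by blast
      obtain J e where J: "finite J" "J \<subseteq> modulus ` G" "e > 0" "basic_nbhd J e x \<subseteq> U"
        using basic_nbhd_in_openin[OF U x(1)] by blast
      obtain F where F: "F \<subseteq> G" "finite F" "J = modulus ` F"
        using finite_subset_image[OF J(1,2)] by blast
      let ?W = "{w \<in> topspace ?Y. \<forall>g\<in>F. w g \<in> ball (g x) e}"
      have "openin ?Y {w \<in> topspace ?Y. w g \<in> ball (g x) e}" if "g \<in> G" for g
        using continuous_map_product_projection[OF that, of "\<lambda>_. euclidean :: 'k topology"]
        by (rule openin_continuous_map_preimage) simp
      then have "openin ?Y (topspace ?Y \<inter> (\<Inter>g\<in>F. {w \<in> topspace ?Y. w g \<in> ball (g x) e}))"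
        using F by (cases "F = {}") (simp_all add: openin_Int openin_INT2 subset_iff del: topspace_product_topology)
      also have "topspace ?Y \<inter> (\<Inter>g\<in>F. {w \<in> topspace ?Y. w g \<in> ball (g x) e}) = ?W"
        by blast
      finally have W: "openin ?Y ?W" .
      have "y \<in> U" if "\<Phi> y \<in> ?W" for y
      proof -
        have "norm (g (y - x)) < e" if "g \<in> F" for g
        proof -
          have "g \<in> G" using that F by blast
          moreover have "\<Phi> y g \<in> ball (g x) e" using \<open>\<Phi> y \<in> ?W\<close> that by blast
          ultimately show ?thesis
            by (simp add: \<Phi>_def dist_norm norm_minus_commute diff)
        qed
        then have "y \<in> basic_nbhd J e x"
          using J(3) F(3) by (simp add: basic_nbhd_def ennreal_less_iff)
        then show ?thesis using J(4) by blast
      qed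
      then have "?W \<inter> range \<Phi> \<subseteq> \<Phi> ` U" by blast
      moreover have "z \<in> ?W \<inter> range \<Phi>"
        using x F J(3) top by (auto simp: \<Phi>_def)
      moreover have "openin ?R (?W \<inter> range \<Phi>)" using W by (rule openin_subtopology_Int)
      ultimately show "\<exists>T. openin ?R T \<and> z \<in> T \<and> T \<subseteq> \<Phi> ` U" by blast
    qed
  qed
  have "inj \<Phi>"
  proof (rule injI, rule ccontr)
    fix x y assume xy: "\<Phi> x = \<Phi> y" "x \<noteq> y"
    then obtain g where g: "g \<in> G" "g (x - y) \<noteq> 0" using sep[of "x - y"] by auto
    then have "\<Phi> x g \<noteq> \<Phi> y g" by (simp add: diff \<Phi>_def)
    then show False using xy by simp
  qed
  then have "homeomorphic_map ?X ?R \<Phi>"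
    using cont open_map topR by (intro bijective_open_imp_homeomorphic_map) simp_all
  then have "?X homeomorphic_space ?R" by (rule homeomorphic_map_imp_homeomorphic_space)
  moreover have "metrizable_space ?Y"
    using G by (auto simp: metrizable_space_product_topology metrizable_space_euclidean)
  ultimately show ?thesis
    using homeomorphic_metrizable_space metrizable_space_subtopology by blast
qed

text \<open>
  Serves to replace a finite set of extended seminorms by a single one.
\<close>

lemma extended_seminorm_SUP:
  fixes smul :: "'k::real_normed_field \<Rightarrow> 'v::ab_group_add \<Rightarrow> 'v"
  assumes "\<And>\<rho>. \<rho> \<in> J \<Longrightarrow> extended_seminorm smul \<rho>"
  shows "extended_seminorm smul (\<lambda>x. SUP \<rho>\<in>J. \<rho> x)"
  unfolding extended_seminorm_def
proof (intro conjI allI)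
  fix a x
  have "(SUP \<rho>\<in>J. \<rho> (smul a x)) = (SUP \<rho>\<in>J. ennreal (norm a) * \<rho> x)"
    using assms by (intro SUP_cong) (auto simp: extended_seminorm_def)
  then show "(SUP \<rho>\<in>J. \<rho> (smul a x)) = ennreal (norm a) * (SUP \<rho>\<in>J. \<rho> x)"
    by (simp add: SUP_mult_left_ennreal)
next
  fix x y
  show "(SUP \<rho>\<in>J. \<rho> (x + y)) \<le> (SUP \<rho>\<in>J. \<rho> x) + (SUP \<rho>\<in>J. \<rho> y)"
  proof (rule SUP_least)
    fix \<rho> assume \<rho>: "\<rho> \<in> J"
    then have "\<rho> (x + y) \<le> \<rho> x + \<rho> y" using assms by (simp add: extended_seminorm_def)
    also have "\<dots> \<le> (SUP \<rho>\<in>J. \<rho> x) + (SUP \<rho>\<in>J. \<rho> y)"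
      using \<rho> by (intro add_mono SUP_upper)
    finally show "\<rho> (x + y) \<le> (SUP \<rho>\<in>J. \<rho> x) + (SUP \<rho>\<in>J. \<rho> y)" .
  qed
qed

section \<open>Seminorms and linear functionals\<close>

text \<open>
  The scalar field may be \<open>real\<close> or \<open>complex\<close>; the arguments treat both at once. What they use of
  the Euclidean structure is completeness and finite dimension over the reals: multiplication
  followed by a fixed nonzero real-linear form is a nondegenerate pairing of the field with itself.
\<close>

locale euclidean_field_vector_space = vector_space smul
  for smul :: "'k::{real_normed_field, euclidean_space} \<Rightarrow> 'v::ab_group_add \<Rightarrow> 'v"  (infixr \<open>*\<^sub>K\<close> 75)
begin

abbreviation real_scale :: "real \<Rightarrow> 'v \<Rightarrow> 'v"  (infixr \<open>*\<^sub>r\<close> 75) where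
  "t *\<^sub>r x \<equiv> of_real t *\<^sub>K x"

definition seminorm :: "('v \<Rightarrow> real) \<Rightarrow> bool" where
  "seminorm p \<longleftrightarrow> (\<forall>a x. p (a *\<^sub>K x) = norm a * p x) \<and> (\<forall>x y. p (x + y) \<le> p x + p y)"

lemma seminorm_scale: "seminorm p \<Longrightarrow> p (a *\<^sub>K x) = norm a * p x"
  and seminorm_add: "seminorm p \<Longrightarrow> p (x + y) \<le> p x + p y"
  by (simp_all add: seminorm_def)

lemma seminorm_zero: "seminorm p \<Longrightarrow> p 0 = 0"
  using seminorm_scale[of p 0 0] by simp

lemma seminorm_minus: "seminorm p \<Longrightarrow> p (- x) = p x"
  using seminorm_scale[of p "- 1" x] by simp

lemma seminorm_nonneg:
  assumes "seminorm p" shows "p x \<ge> 0"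
  using seminorm_add[OF assms, of x "- x"] seminorm_zero[OF assms] seminorm_minus[OF assms] by simp

lemma linear_functional_iff:
  "Vector_Spaces.linear smul (*) f \<longleftrightarrow>
     (\<forall>x y. f (x + y) = f x + f y) \<and> (\<forall>a x. f (a *\<^sub>K x) = a * f x)"
  by (simp add: Vector_Spaces.linear_iff vector_space_axioms
      vector_space_over_itself.vector_space_axioms)

abbreviation functional :: "('v \<Rightarrow> 'k) \<Rightarrow> bool" where
  "functional \<equiv> Vector_Spaces.linear smul (*)"

lemma functional_add: "functional f \<Longrightarrow> f (x + y) = f x + f y"
  and functional_scale: "functional f \<Longrightarrow> f (a *\<^sub>K x) = a * f x"
  by (simp_all add: linear_functional_iff)

lemma functional_diff: "functional f \<Longrightarrow> f (x - y) = f x - f y"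
  using functional_add[of f "x - y" y] by simp

lemma seminorm_norm_functional: "functional f \<Longrightarrow> seminorm (\<lambda>x. norm (f x))"
  by (simp add: seminorm_def functional_add functional_scale norm_mult norm_triangle_ineq)

section \<open>Hahn-Banach extension\<close>

text \<open>
  The inequality for positive factors is enough: it implies equality and \<open>q 0 = 0\<close>, see
  \<open>sublinear_scale\<close> and \<open>sublinear_zero\<close>.
\<close>

definition sublinear :: "('v \<Rightarrow> real) \<Rightarrow> bool" where
  "sublinear q \<longleftrightarrow> (\<forall>x y. q (x + y) \<le> q x + q y) \<and> (\<forall>t>0. \<forall>x. q (t *\<^sub>r x) \<le> t * q x)"

lemma sublinear_add: "sublinear q \<Longrightarrow> q (x + y) \<le> q x + q y"
  by (simp add: sublinear_def)

lemma sublinear_scale_le: "sublinear q \<Longrightarrow> t > 0 \<Longrightarrow> q (t *\<^sub>r x) \<le> t * q x"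
  by (simp add: sublinear_def)

lemma sublinear_zero:
  assumes "sublinear q" shows "q 0 = 0"
  using sublinear_scale_le[OF assms, of 2 0] sublinear_scale_le[OF assms, of "1/2" 0] by simp

lemma sublinear_scale:
  assumes q: "sublinear q" and t: "t \<ge> 0"
  shows "q (t *\<^sub>r x) = t * q x"
proof (cases "t = 0")
  case True
  then show ?thesis using sublinear_zero[OF q] by simp
next
  case False
  then have pos: "t > 0" using t by simp
  have "q x = q ((1/t) *\<^sub>r t *\<^sub>r x)" using pos by (simp flip: of_real_mult)
  also have "\<dots> \<le> (1/t) * q (t *\<^sub>r x)" using pos by (intro sublinear_scale_le q) auto
  finally have "t * q x \<le> q (t *\<^sub>r x)" using pos by (simp add: field_simps)
  then show ?thesis using sublinear_scale_le[OF q pos, of x] by simp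
qed

lemma sublinear_lower_bound:
  assumes "sublinear q" shows "- q (- x) \<le> q x"
  using sublinear_add[OF assms, of x "- x"] sublinear_zero[OF assms] by simp

text \<open>
  For sublinear \<open>q\<close> this is a sublinear function below \<open>q\<close> whose value at \<open>- y\<close> has been lowered to
  the smallest possible one, \<open>- q y\<close>. It serves twice: it shows that a minimal sublinear function is
  odd, and it forces a linear function below it to agree with \<open>q\<close> at \<open>y\<close>.
\<close>

definition tilt :: "('v \<Rightarrow> real) \<Rightarrow> 'v \<Rightarrow> 'v \<Rightarrow> real" where
  "tilt q y x = (INF t\<in>{0..}. q (x + t *\<^sub>r y) - t * q y)"

lemma tilt_le:
  assumes q: "sublinear q" and t: "t \<ge> 0"
  shows "tilt q y x \<le> q (x + t *\<^sub>r y) - t * q y"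
  unfolding tilt_def
proof (rule cINF_lower)
  have "- q (- x) \<le> q (x + t *\<^sub>r y) - t * q y" if "t \<ge> 0" for t
    using sublinear_add[OF q, of "- x" "x + t *\<^sub>r y"] sublinear_scale[OF q that, of y] by simp
  then show "bdd_below ((\<lambda>t. q (x + t *\<^sub>r y) - t * q y) ` {0..})"
    by (auto simp: bdd_below_def)
qed (use t in simp)

lemma tilt_greatest:
  assumes "\<And>t. t \<ge> 0 \<Longrightarrow> c \<le> q (x + t *\<^sub>r y) - t * q y"
  shows "c \<le> tilt q y x"
  unfolding tilt_def by (rule cINF_greatest) (use assms in auto)

lemma tilt_below:
  assumes "sublinear q" shows "tilt q y x \<le> q x"
  using tilt_le[OF assms, of 0 y x] by simp

lemma tilt_at_minus:
  assumes "sublinear q" shows "tilt q y (- y) \<le> - q y"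
  using tilt_le[OF assms, of 1 y "- y"] sublinear_zero[OF assms] by simp

lemma sublinear_tilt:
  assumes q: "sublinear q" shows "sublinear (tilt q y)"
  unfolding sublinear_def
proof (intro conjI allI impI)
  fix x x'
  have "tilt q y (x + x') - (q (x' + s *\<^sub>r y) - s * q y) \<le> q (x + t *\<^sub>r y) - t * q y"
    if "t \<ge> 0" "s \<ge> 0" for t s
  proof -
    have "tilt q y (x + x') \<le> q (x + x' + (t + s) *\<^sub>r y) - (t + s) * q y"
      using that by (intro tilt_le q) simp
    also have "x + x' + (t + s) *\<^sub>r y = (x + t *\<^sub>r y) + (x' + s *\<^sub>r y)"
      by (simp add: scale_left_distrib algebra_simps)
    also have "q \<dots> \<le> q (x + t *\<^sub>r y) + q (x' + s *\<^sub>r y)" by (rule sublinear_add[OF q])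
    finally show ?thesis by (simp add: algebra_simps)
  qed
  then have "tilt q y (x + x') - (q (x' + s *\<^sub>r y) - s * q y) \<le> tilt q y x" if "s \<ge> 0" for s
    using that by (intro tilt_greatest)
  then have "tilt q y (x + x') - tilt q y x \<le> tilt q y x'"
    by (intro tilt_greatest) (simp add: algebra_simps)
  then show "tilt q y (x + x') \<le> tilt q y x + tilt q y x'" by simp
next
  fix c :: real and x assume c: "c > 0"
  have "tilt q y (c *\<^sub>r x) / c \<le> q (x + t *\<^sub>r y) - t * q y" if t: "t \<ge> 0" for t
  proof -
    have "tilt q y (c *\<^sub>r x) \<le> q (c *\<^sub>r x + (c * t) *\<^sub>r y) - (c * t) * q y"
      using c t by (intro tilt_le q) simp
    also have "c *\<^sub>r x + (c * t) *\<^sub>r y = c *\<^sub>r (x + t *\<^sub>r y)"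
      by (simp add: scale_right_distrib)
    also have "q \<dots> = c * q (x + t *\<^sub>r y)" using c by (intro sublinear_scale q) simp
    finally show ?thesis using c by (simp add: field_simps)
  qed
  then have "tilt q y (c *\<^sub>r x) / c \<le> tilt q y x" by (rule tilt_greatest)
  then show "tilt q y (c *\<^sub>r x) \<le> c * tilt q y x" using c by (simp add: field_simps)
qed

definition real_linear :: "('v \<Rightarrow> real) \<Rightarrow> bool" where
  "real_linear g \<longleftrightarrow> (\<forall>x y. g (x + y) = g x + g y) \<and> (\<forall>t x. g (t *\<^sub>r x) = t * g x)"

text \<open>
  Minimality gives \<open>tilt q y = q\<close> for every \<open>y\<close>, so \<open>q (- y) = - q y\<close>; an odd sublinear function
  is additive because subadditivity can be applied to \<open>- y\<close> as well.
\<close>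

lemma real_linear_if_minimal:
  assumes q: "sublinear q" and min: "\<And>r. sublinear r \<Longrightarrow> r \<le> q \<Longrightarrow> r = q"
  shows "real_linear q"
proof -
  have "tilt q y = q" for y
    using sublinear_tilt[OF q] tilt_below[OF q] by (intro min) (auto simp: le_fun_def)
  then have minus: "q (- y) = - q y" for y
    using tilt_at_minus[OF q, of y] sublinear_lower_bound[OF q, of y] by (metis minus_le_iff order_antisym)
  have add: "q (x + y) = q x + q y" for x y
    using sublinear_add[OF q, of x y] sublinear_add[OF q, of "x + y" "- y"] minus[of y] by simp
  have "q (t *\<^sub>r x) = t * q x" for t x
  proof (cases "t \<ge> 0")
    case True then show ?thesis by (rule sublinear_scale[OF q])
  next
    case False
    then have "q (- ((- t) *\<^sub>r x)) = t * q x"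
      using sublinear_scale[OF q, of "- t" x] by (simp only: minus)
    then show ?thesis by simp
  qed
  then show ?thesis using add by (simp add: real_linear_def)
qed

text \<open>
  The infimum is finite because all members lie above \<open>- q (- x)\<close>, and subadditive because any two
  members of the chain have a common lower bound in the chain.
\<close>

lemma sublinear_chain_Inf:
  assumes C: "C \<noteq> {}" and sub: "\<And>r. r \<in> C \<Longrightarrow> sublinear r"
    and bound: "\<And>r. r \<in> C \<Longrightarrow> r \<le> q"
    and chain: "\<And>r s. r \<in> C \<Longrightarrow> s \<in> C \<Longrightarrow> r \<le> s \<or> s \<le> r"
  defines "m \<equiv> \<lambda>x. INF r\<in>C. r x"
  shows "sublinear m" and "\<And>r. r \<in> C \<Longrightarrow> m \<le> r"
proof -
  have "- q (- x) \<le> r x" if "r \<in> C" for r x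
    using sublinear_lower_bound[OF sub[OF that], of x] bound[OF that]
    by (meson le_funD neg_le_iff_le order_trans)
  then have bdd: "bdd_below ((\<lambda>r. r x) ` C)" for x
    by (auto simp: bdd_below_def)
  have le: "m x \<le> r x" if "r \<in> C" for r x
    unfolding m_def using that bdd by (intro cINF_lower)
  then show "\<And>r. r \<in> C \<Longrightarrow> m \<le> r" by (simp add: le_fun_def)
  have greatest: "c \<le> m x" if "\<And>r. r \<in> C \<Longrightarrow> c \<le> r x" for c x
    unfolding m_def using that C by (intro cINF_greatest)
  show "sublinear m"
    unfolding sublinear_def
  proof (intro conjI allI impI)
    fix x y
    have "m (x + y) \<le> r x + s y" if rs: "r \<in> C" "s \<in> C" for r s
    proof -
      obtain u where u: "u \<in> C" "u \<le> r" "u \<le> s" using chain[OF rs] rs by blast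
      have "m (x + y) \<le> u x + u y"
        using le[OF u(1)] sublinear_add[OF sub[OF u(1)], of x y] order_trans by blast
      also have "\<dots> \<le> r x + s y" using u by (intro add_mono) (auto simp: le_fun_def)
      finally show ?thesis .
    qed
    then have "m (x + y) - s y \<le> m x" if "s \<in> C" for s
      using that by (intro greatest) (simp add: algebra_simps)
    then have "m (x + y) - m x \<le> m y"
      by (intro greatest) (simp add: algebra_simps)
    then show "m (x + y) \<le> m x + m y" by simp
  next
    fix t :: real and x assume t: "t > 0"
    have "m (t *\<^sub>r x) / t \<le> r x" if "r \<in> C" for r
      using le[OF that, of "t *\<^sub>r x"] sublinear_scale_le[OF sub[OF that] t, of x] t
      by (simp add: field_simps)
    then have "m (t *\<^sub>r x) / t \<le> m x" by (rule greatest)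
    then show "m (t *\<^sub>r x) \<le> t * m x" using t by (simp add: field_simps)
  qed
qed

text \<open>
  Zorn's lemma gives a minimal sublinear function below \<open>q\<close>. Working with sublinear functions on the
  whole space avoids extending functionals from subspaces step by step.
\<close>

lemma real_linear_below_sublinear:
  assumes q: "sublinear q"
  obtains g where "real_linear g" "g \<le> q"
proof -
  define A where "A = {r. sublinear r \<and> r \<le> q}"
  have "\<exists>m\<in>A. \<forall>a\<in>A. (\<lambda>r s. s \<le> r) m a \<longrightarrow> a = m"
  proof (rule predicate_Zorn)
    show "partial_order_on A (relation_of (\<lambda>r s. s \<le> r) A)"
      by (rule partial_order_on_relation_ofI) auto
  next
    fix C assume C: "C \<in> Chains (relation_of (\<lambda>r s. s \<le> r) A)"
    then have sub: "C \<subseteq> A" and chain: "\<And>r s. r \<in> C \<Longrightarrow> s \<in> C \<Longrightarrow> r \<le> s \<or> s \<le> r"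
      by (auto simp: Chains_def relation_of_def)
    show "\<exists>u\<in>A. \<forall>a\<in>C. u \<le> a"
    proof (cases "C = {}")
      case True
      then show ?thesis using q by (auto simp: A_def)
    next
      case False
      have *: "sublinear r" "r \<le> q" if "r \<in> C" for r using sub that by (auto simp: A_def)
      note m = sublinear_chain_Inf[OF False * chain]
      then show ?thesis using False *(2) unfolding A_def
        by (intro bexI[of _ "\<lambda>x. INF r\<in>C. r x"]) (auto intro: order_trans)
    qed
  qed
  then obtain m where m: "sublinear m" "m \<le> q" "\<And>a. sublinear a \<Longrightarrow> a \<le> q \<Longrightarrow> a \<le> m \<Longrightarrow> a = m"
    by (auto simp: A_def)
  then show thesis
    using that real_linear_if_minimal[of m] order_trans by blast
qed

lemma sublinear_seminorm: "seminorm p \<Longrightarrow> sublinear p"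
  by (simp add: seminorm_def sublinear_def)

text \<open>
  The bilinear form \<open>(a, b) \<mapsto> (a * b) \<bullet> 1\<close> on the field is nondegenerate: if \<open>b\<close> is nonzero, then
  \<open>(inverse b * b) \<bullet> 1\<close> is nonzero. In finite dimension it therefore represents every linear form.
  For the complex numbers \<open>(a * b) \<bullet> 1\<close> is the real part of \<open>a * b\<close>.
\<close>

lemma scalar_inner_representation:
  fixes \<phi> :: "'k \<Rightarrow> real"
  assumes "linear \<phi>"
  shows "\<exists>!b. \<forall>a. \<phi> a = (a * b) \<bullet> 1"
proof -
  define T :: "'k \<Rightarrow> 'k" where "T b = (\<Sum>e\<in>Basis. ((e * b) \<bullet> 1) *\<^sub>R e)" for b
  have T: "(a * b) \<bullet> 1 = a \<bullet> T b" for a b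
  proof -
    have lin: "linear (\<lambda>a. (a * b) \<bullet> (1::'k))"
      by (intro linearI) (simp_all add: distrib_right inner_add_left)
    have "(a * b) \<bullet> 1 = (\<lambda>a. (a * b) \<bullet> 1) (\<Sum>e\<in>Basis. (a \<bullet> e) *\<^sub>R e)"
      by (simp add: euclidean_representation)
    also have "\<dots> = (\<Sum>e\<in>Basis. (a \<bullet> e) * ((e * b) \<bullet> 1))"
      by (subst Real_Vector_Spaces.linear_sum[OF lin]) (simp add: linear_scale[OF lin])
    also have "\<dots> = a \<bullet> T b"
      by (simp add: T_def inner_sum_right mult.commute)
    finally show ?thesis .
  qed
  have lin: "linear T"
    unfolding T_def
    by (intro linearI) (simp_all add: distrib_left inner_add_left scaleR_add_left sum.distrib scaleR_sum_right)
  have inj: "b = 0" if "T b = 0" for b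
  proof (rule ccontr)
    assume b: "b \<noteq> 0"
    have "(inverse b * b) \<bullet> (1::'k) = 0" using T[of "inverse b" b] that by simp
    then show False using b by simp
  qed
  then have inj: "inj T" by (simp add: linear_injective_0[OF lin])
  then have "surj T" using lin by (simp add: linear_injective_imp_surjective)
  then obtain b where b: "T b = (\<Sum>e\<in>Basis. \<phi> e *\<^sub>R e)" by (metis surjD)
  have \<phi>: "\<phi> a = a \<bullet> T b" for a
  proof -
    have "\<phi> a = \<phi> (\<Sum>e\<in>Basis. (a \<bullet> e) *\<^sub>R e)" by (simp add: euclidean_representation)
    also have "\<dots> = (\<Sum>e\<in>Basis. (a \<bullet> e) * \<phi> e)"
      by (subst Real_Vector_Spaces.linear_sum[OF assms]) (simp add: linear_scale[OF assms])
    also have "\<dots> = a \<bullet> T b" by (simp add: b inner_sum_right mult.commute)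
    finally show ?thesis .
  qed
  show ?thesis
  proof (rule ex1I[of _ b])
    show "\<forall>a. \<phi> a = (a * b) \<bullet> 1" using \<phi> T by simp
  next
    fix c assume "\<forall>a. \<phi> a = (a * c) \<bullet> 1"
    then have "a \<bullet> T c = a \<bullet> T b" for a using \<phi> T by metis
    then have "T c = T b" using vector_eq_ldot[of "T c" "T b"] by blast
    then show "c = b" using inj by (simp add: inj_eq)
  qed
qed

text \<open>
  Generalizes the passage from a real functional \<open>g\<close> to the complex functional
  \<open>f x = g x - \<i> * g (\<i> * x)\<close>, whose real part is \<open>g\<close>. Uniqueness of the representing
  scalar \<open>f x\<close> makes \<open>f\<close> linear over the whole field.
\<close>

lemma functional_from_real_linear:
  assumes g: "real_linear g"
  obtains f where "Vector_Spaces.linear smul (*) f" "\<And>a x. g (a *\<^sub>K x) = (a * f x) \<bullet> 1"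
proof -
  have add: "g (x + y) = g x + g y" and sc: "g (t *\<^sub>r x) = t * g x" for x y t
    using g by (auto simp: real_linear_def)
  have "linear (\<lambda>a. g (a *\<^sub>K x))" for x
  proof (rule linearI)
    show "g ((r *\<^sub>R b) *\<^sub>K x) = r *\<^sub>R g (b *\<^sub>K x)" for r b
      using sc[of r "b *\<^sub>K x"] by (simp add: scaleR_conv_of_real)
  qed (simp add: scale_left_distrib add)
  then have ex1: "\<exists>!b. \<forall>a. g (a *\<^sub>K x) = (a * b) \<bullet> 1" for x by (rule scalar_inner_representation)
  then obtain f where f: "\<And>a x. g (a *\<^sub>K x) = (a * f x) \<bullet> 1" by metis
  have uniq: "f x = b" if "\<And>a. g (a *\<^sub>K x) = (a * b) \<bullet> 1" for x b using ex1 f that by blast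
  have "f (x + y) = f x + f y" for x y
    by (rule uniq) (simp add: scale_right_distrib add f distrib_left inner_add_left)
  moreover have "f (c *\<^sub>K x) = c * f x" for c x
    by (rule uniq) (simp add: f mult.assoc)
  ultimately have "Vector_Spaces.linear smul (*) f" by (simp add: linear_functional_iff)
  then show thesis using f by (rule that)
qed

text \<open>
  A real-linear function below \<open>tilt p x\<close> lies below \<open>p\<close> and equals \<open>p\<close> at \<open>x\<close>. The bound on the
  functional over the field comes from multiplying \<open>y\<close> by the scalar \<open>inverse (f y)\<close>.
\<close>

proposition Hahn_Banach_seminorm:
  assumes p: "seminorm p"
  obtains f where "Vector_Spaces.linear smul (*) f" "\<And>x. norm (f x) \<le> p x"
    "p x \<le> norm (f x)"
proof -
  note s = sublinear_seminorm[OF p]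
  obtain g where g: "real_linear g" "g \<le> tilt p x"
    using real_linear_below_sublinear[OF sublinear_tilt[OF s]] by blast
  obtain f where f: "Vector_Spaces.linear smul (*) f" "\<And>a x. g (a *\<^sub>K x) = (a * f x) \<bullet> 1"
    using functional_from_real_linear[OF g(1)] by blast
  have gp: "g y \<le> p y" for y using g(2) tilt_below[OF s, of x y] by (meson le_funD order_trans)
  show thesis
  proof (rule that[OF f(1)])
    fix y
    show "norm (f y) \<le> p y"
    proof (cases "f y = 0")
      case True then show ?thesis using seminorm_nonneg[OF p, of y] by simp
    next
      case False
      have "1 = g (inverse (f y) *\<^sub>K y)" using False f(2)[of "inverse (f y)" y]
        by (simp add: dot_square_norm)
      also have "\<dots> \<le> inverse (norm (f y)) * p y"
        using gp[of "inverse (f y) *\<^sub>K y"] by (simp add: seminorm_scale[OF p] norm_inverse)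
      finally show ?thesis using False by (simp add: field_simps)
    qed
    have "g (- 1 *\<^sub>K x) \<le> - p x"
      using g(2) tilt_at_minus[OF s, of x] by (metis le_funD order_trans scale_minus_left scale_one)
    then have "p x \<le> f x \<bullet> 1" using f(2)[of "-1" x] by simp
    also have "\<dots> \<le> norm (f x)" using norm_cauchy_schwarz[of "f x" 1] by simp
    finally show "p x \<le> norm (f x)" by (simp add: mult.commute)
  qed
qed

section \<open>Functionals avoiding countably many kernels\<close>

text \<open>
  A gliding hump. The functional is a series in which the \<open>n\<close>-th term is either zero or \<open>(1/4) ^ n\<close>
  times a Hahn-Banach functional for \<open>x n\<close>, chosen so that the partial sum has modulus at least
  \<open>(1/4) ^ n * p (x n) / 2\<close> at \<open>x n\<close>. All later terms together contribute at most
  \<open>(1/4) ^ n * p (x n) / 3\<close> there, too little to bring the value back to zero.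
\<close>

proposition functional_nonzero_on_sequence:
  assumes p: "seminorm p" and x: "\<And>n::nat. p (x n) > 0"
  obtains f where "functional f" "\<And>y. norm (f y) \<le> 2 * p y" "\<And>n. f (x n) \<noteq> 0"
proof -
  let ?d = "\<lambda>n::nat. (1/4::real) ^ n"
  have "\<exists>F. \<forall>n::nat. (functional (F n) \<and> (n = 0 \<longrightarrow> F n = (\<lambda>_. 0))) \<and>
    ((\<forall>y. norm (F (Suc n) y - F n y) \<le> ?d n * p y) \<and>
     ?d n * p (x n) / 2 \<le> norm (F (Suc n) (x n)))"
  proof (rule dependent_nat_choice)
    show "\<exists>f. functional f \<and> ((0::nat) = 0 \<longrightarrow> f = (\<lambda>_. 0))" by (simp add: linear_functional_iff)
  next
    fix F :: "'v \<Rightarrow> 'k" and n :: nat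
    assume F: "functional F \<and> (n = 0 \<longrightarrow> F = (\<lambda>_. 0))"
    show "\<exists>G. (functional G \<and> (Suc n = 0 \<longrightarrow> G = (\<lambda>_. 0))) \<and>
       ((\<forall>y. norm (G y - F y) \<le> ?d n * p y) \<and> ?d n * p (x n) / 2 \<le> norm (G (x n)))"
    proof (cases "?d n * p (x n) / 2 \<le> norm (F (x n))")
      \<comment> \<open>The partial sum is already large at \<open>x n\<close>, so the next coefficient is zero.\<close>
      case True
      then show ?thesis using F seminorm_nonneg[OF p] by (intro exI[of _ F]) simp
    next
      \<comment> \<open>Here the old value is below half the size of the new term at \<open>x n\<close>, so it cannot cancel it.\<close>
      case False
      obtain g where g: "functional g" "\<And>y. norm (g y) \<le> p y" "p (x n) \<le> norm (g (x n))"
        using Hahn_Banach_seminorm[OF p] by blast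
      let ?G = "\<lambda>y. F y + of_real (?d n) * g y"
      have "functional ?G" using F g(1) by (simp add: linear_functional_iff algebra_simps)
      moreover have "norm (?G y - F y) \<le> ?d n * p y" for y
        using mult_left_mono[OF g(2)[of y], of "?d n"]
        by (simp add: norm_mult norm_power norm_divide del: power_divide of_real_power)
      moreover have "?d n * p (x n) / 2 \<le> norm (?G (x n))"
      proof -
        have "?d n * p (x n) \<le> norm (of_real (?d n) * g (x n))"
          using mult_left_mono[OF g(3), of "?d n"]
          by (simp add: norm_mult norm_power norm_divide del: power_divide of_real_power)
        also have "\<dots> \<le> norm (?G (x n)) + norm (F (x n))"
          using norm_triangle_ineq4[of "?G (x n)" "F (x n)"] by simp
        finally show ?thesis using False by simp
      qed
      ultimately show ?thesis by (intro exI[of _ ?G]) blast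
    qed
  qed
  then obtain F where F: "\<And>n. functional (F n)" "F 0 = (\<lambda>_. 0)"
    "\<And>n y. norm (F (Suc n) y - F n y) \<le> ?d n * p y"
    "\<And>n. ?d n * p (x n) / 2 \<le> norm (F (Suc n) (x n))" by blast
  have tail: "norm (F (m + k) y - F m y) \<le> 4/3 * (?d m - ?d (m + k)) * p y" for m k y
  proof (induction k)
    case (Suc k)
    have "norm (F (m + Suc k) y - F m y)
        \<le> norm (F (Suc (m + k)) y - F (m + k) y) + norm (F (m + k) y - F m y)"
      using norm_triangle_ineq[of "F (Suc (m + k)) y - F (m + k) y" "F (m + k) y - F m y"] by simp
    also have "\<dots> \<le> ?d (m + k) * p y + 4/3 * (?d m - ?d (m + k)) * p y"
      using F(3) Suc by (intro add_mono)
    also have "\<dots> = 4/3 * (?d m - ?d (m + Suc k)) * p y" by (simp add: algebra_simps)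
    finally show ?case .
  qed simp
  have "convergent (\<lambda>n. F n y)" for y
  proof -
    have "summable (\<lambda>n. F (Suc n) y - F n y)"
    proof (rule summable_comparison_test)
      show "summable (\<lambda>n. ?d n * p y)" by (intro summable_mult2 summable_geometric) simp
    qed (use F(3) in blast)
    then have "convergent (\<lambda>n. F n y - F 0 y)"
      unfolding summable_iff_convergent sum_lessThan_telescope[of "\<lambda>n. F n y"] .
    then show ?thesis by (simp add: convergent_diff_const_right_iff)
  qed
  then obtain f where f: "\<And>y. (\<lambda>n. F n y) \<longlonglongrightarrow> f y" unfolding convergent_def by metis
  have "functional f"
    unfolding linear_functional_iff
  proof (intro conjI allI)
    fix y z
    have "(\<lambda>n. F n (y + z)) \<longlonglongrightarrow> f y + f z"
      unfolding functional_add[OF F(1)] by (intro tendsto_add f)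
    then show "f (y + z) = f y + f z" using f LIMSEQ_unique by blast
  next
    fix a y
    have "(\<lambda>n. F n (a *\<^sub>K y)) \<longlonglongrightarrow> a * f y"
      unfolding functional_scale[OF F(1)] by (intro tendsto_mult f tendsto_const)
    then show "f (a *\<^sub>K y) = a * f y" using f LIMSEQ_unique by blast
  qed
  moreover have bound: "norm (f y - F m y) \<le> 4/3 * ?d m * p y" for m y
  proof (rule LIMSEQ_le_const2)
    show "(\<lambda>k. norm (F (k + m) y - F m y)) \<longlonglongrightarrow> norm (f y - F m y)"
      by (rule tendsto_norm[OF tendsto_diff[OF LIMSEQ_ignore_initial_segment[OF f] tendsto_const]])
    have "norm (F (k + m) y - F m y) \<le> 4/3 * ?d m * p y" for k
    proof -
      have "4/3 * (?d m - ?d (m + k)) * p y \<le> 4/3 * ?d m * p y"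
        using seminorm_nonneg[OF p] by (intro mult_right_mono) auto
      then show ?thesis using tail[of m k y] by (simp add: add.commute)
    qed
    then show "\<exists>N. \<forall>k\<ge>N. norm (F (k + m) y - F m y) \<le> 4/3 * ?d m * p y" by blast
  qed
  moreover have "norm (f y) \<le> 2 * p y" for y
    using bound[of y 0] F(2) seminorm_nonneg[OF p, of y] by simp
  moreover have "f (x n) \<noteq> 0" for n
  proof
    assume "f (x n) = 0"
    then have "norm (F (Suc n) (x n)) \<le> ?d n * p (x n) / 3"
      using bound[of "x n" "Suc n"] by simp
    then have "?d n * p (x n) \<le> 0" using F(4)[of n] by linarith
    moreover have "?d n * p (x n) > 0" using x[of n] by simp
    ultimately show False by linarith
  qed
  ultimately show thesis using that by blast
qed

section \<open>Seminorms controlled by finitely many functionals\<close>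

text \<open>
  The common kernel is closed under scaling, and a seminorm that is bounded along the line through a
  point is zero at that point.
\<close>

lemma seminorm_zero_on_common_kernel:
  assumes p: "seminorm p" and F: "\<And>f. f \<in> F \<Longrightarrow> functional f"
    and bound: "\<And>x. x \<in> common_kernel F \<Longrightarrow> p x < \<epsilon>" and x: "x \<in> common_kernel F"
  shows "p x = 0"
proof (rule ccontr)
  assume "p x \<noteq> 0"
  then have pos: "p x > 0" using seminorm_nonneg[OF p, of x] by simp
  have "\<epsilon> > 0" using bound[OF x] pos by simp
  have "(\<epsilon> / p x) *\<^sub>r x \<in> common_kernel F"
    using x F by (simp add: common_kernel_def functional_scale)
  then have "p ((\<epsilon> / p x) *\<^sub>r x) < \<epsilon>" by (rule bound)
  then show False using pos \<open>\<epsilon> > 0\<close> by (simp add: seminorm_scale[OF p] norm_divide)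
qed

text \<open>
  Induction on \<open>F\<close>. If \<open>h\<close> vanishes on the common kernel of \<open>F\<close>, it adds no constraint. Otherwise pick
  \<open>e\<close> in that kernel with \<open>h e = 1\<close>: subtracting \<open>h x\<close> times \<open>e\<close> moves \<open>x\<close> into the kernel of \<open>h\<close> without
  changing its values under \<open>F\<close>, so the induction hypothesis applies to \<open>p\<close> after this correction.
\<close>

lemma seminorm_le_sum_functionals:
  assumes "finite F" "\<And>f. f \<in> F \<Longrightarrow> functional f" "seminorm p"
    "\<And>x. x \<in> common_kernel F \<Longrightarrow> p x = 0"
  shows "\<exists>C\<ge>0. \<forall>x. p x \<le> C * (\<Sum>f\<in>F. norm (f x))"
  using assms
proof (induction F arbitrary: p rule: finite_induct)
  case empty
  then show ?case by (intro exI[of _ 0]) (simp add: common_kernel_def)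
next
  case (insert h F)
  note p = \<open>seminorm p\<close>
  have h: "functional h" using insert.prems by blast
  have sum: "(\<Sum>f\<in>insert h F. norm (f x)) = norm (h x) + (\<Sum>f\<in>F. norm (f x))" for x
    using insert.hyps by simp
  show ?case
  proof (cases "\<forall>x\<in>common_kernel F. h x = 0")
    case True
    then have "p x = 0" if "x \<in> common_kernel F" for x
      using that insert.prems(3)[of x] by (auto simp: common_kernel_def)
    then obtain C where C: "C \<ge> 0" "\<And>x. p x \<le> C * (\<Sum>f\<in>F. norm (f x))"
      using insert.IH[of p] insert.prems by auto
    have "p x \<le> C * (\<Sum>f\<in>insert h F. norm (f x))" for x
      using C(2)[of x] C(1) unfolding sum by (simp add: distrib_left add_increasing)
    then show ?thesis using C(1) by blast
  next
    case False
    then obtain u where u: "u \<in> common_kernel F" "h u \<noteq> 0" by blast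
    define e where "e = inverse (h u) *\<^sub>K u"
    have e: "e \<in> common_kernel F" "h e = 1"
      using u insert.prems(1) by (auto simp: e_def common_kernel_def functional_scale)
    define q where "q x = p (x - h x *\<^sub>K e)" for x
    have "seminorm q"
      unfolding seminorm_def
    proof (intro conjI allI)
      fix a x
      have "a *\<^sub>K x - h (a *\<^sub>K x) *\<^sub>K e = a *\<^sub>K (x - h x *\<^sub>K e)"
        by (simp add: functional_scale[OF h] scale_right_diff_distrib)
      then show "q (a *\<^sub>K x) = norm a * q x" by (simp add: q_def seminorm_scale[OF p])
    next
      fix x y
      have "x + y - h (x + y) *\<^sub>K e = (x - h x *\<^sub>K e) + (y - h y *\<^sub>K e)"
        by (simp add: functional_add[OF h] scale_left_distrib algebra_simps)
      then show "q (x + y) \<le> q x + q y" using seminorm_add[OF p] by (simp only: q_def)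
    qed
    moreover have "q x = 0" if "x \<in> common_kernel F" for x
      unfolding q_def
    proof (rule insert.prems(3))
      show "x - h x *\<^sub>K e \<in> common_kernel (insert h F)"
        using that e insert.prems(1)
        by (auto simp: common_kernel_def functional_diff functional_scale)
    qed
    ultimately obtain C where C: "C \<ge> 0" "\<And>x. q x \<le> C * (\<Sum>f\<in>F. norm (f x))"
      using insert.IH[of q] insert.prems(1) by auto
    have "p x \<le> (C + p e) * (\<Sum>f\<in>insert h F. norm (f x))" for x
    proof -
      have "p x \<le> q x + norm (h x) * p e"
        using seminorm_add[OF p, of "x - h x *\<^sub>K e" "h x *\<^sub>K e"]
        by (simp add: q_def seminorm_scale[OF p])
      also have "\<dots> \<le> C * (\<Sum>f\<in>F. norm (f x)) + norm (h x) * p e" using C(2) by simp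
      also have "\<dots> \<le> (C + p e) * (\<Sum>f\<in>insert h F. norm (f x))"
        using C(1) seminorm_nonneg[OF p, of e] unfolding sum
        by (simp add: algebra_simps sum_nonneg)
      finally show ?thesis .
    qed
    then show ?thesis using C(1) seminorm_nonneg[OF p, of e] by (intro exI[of _ "C + p e"]) simp
  qed
qed

lemma seminorm_small_near_common_kernel:
  assumes F: "finite F" "\<And>f. f \<in> F \<Longrightarrow> functional f" and p: "seminorm p"
    "\<And>x. x \<in> common_kernel F \<Longrightarrow> p x = 0" and \<epsilon>: "\<epsilon> > 0"
  obtains \<delta> where "\<delta> > 0" "\<And>x. x \<in> basic_nbhd (modulus ` F) \<delta> 0 \<Longrightarrow> p x < \<epsilon>"
proof -
  obtain C where C: "C \<ge> 0" "\<And>x. p x \<le> C * (\<Sum>f\<in>F. norm (f x))"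
    using seminorm_le_sum_functionals[OF F p] by blast
  define \<delta> where "\<delta> = \<epsilon> / (C * card F + 1)"
  have den: "C * card F + 1 > 0" using C(1) by (simp add: add_nonneg_pos)
  then have \<delta>: "\<delta> > 0" using \<epsilon> by (simp add: \<delta>_def)
  have "p x < \<epsilon>" if "x \<in> basic_nbhd (modulus ` F) \<delta> 0" for x
  proof -
    have "norm (f x) \<le> \<delta>" if "f \<in> F" for f
      using \<open>x \<in> basic_nbhd (modulus ` F) \<delta> 0\<close> that by (auto simp: basic_nbhd_def ennreal_less_iff)
    then have "C * (\<Sum>f\<in>F. norm (f x)) \<le> C * (card F * \<delta>)"
      using C(1) by (intro mult_left_mono sum_bounded_above[of F, THEN order_trans]) auto
    also have "\<dots> < (C * card F + 1) * \<delta>" using \<delta> by (simp add: algebra_simps)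
    also have "\<dots> = \<epsilon>" using den by (simp add: \<delta>_def)
    finally show ?thesis using C(2)[of x] by simp
  qed
  then show thesis using that \<delta> by blast
qed

section \<open>Continuity and the weak topology\<close>

lemma extended_seminorm_scale: "extended_seminorm smul \<rho> \<Longrightarrow> \<rho> (a *\<^sub>K x) = ennreal (norm a) * \<rho> x"
  and extended_seminorm_add: "extended_seminorm smul \<rho> \<Longrightarrow> \<rho> (x + y) \<le> \<rho> x + \<rho> y"
  by (simp_all add: extended_seminorm_def)

lemma finite_seminorm_ennreal:
  assumes "seminorm p" shows "finite_seminorm smul (\<lambda>x. ennreal (p x))"
  using seminorm_nonneg[OF assms] seminorm_add[OF assms]
  by (simp add: finite_seminorm_def extended_seminorm_def seminorm_scale[OF assms] ennreal_mult
      flip: ennreal_plus)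

lemma seminorm_enn2real:
  assumes "finite_seminorm smul \<rho>"
  obtains p where "seminorm p" "\<rho> = (\<lambda>x. ennreal (p x))"
proof
  have \<rho>: "extended_seminorm smul \<rho>" and fin: "\<rho> x < top" for x
    using assms by (simp_all add: finite_seminorm_def)
  show "\<rho> = (\<lambda>x. ennreal (enn2real (\<rho> x)))" using fin by simp
  have "enn2real (\<rho> (x + y)) \<le> enn2real (\<rho> x) + enn2real (\<rho> y)" for x y
  proof -
    have "enn2real (\<rho> (x + y)) \<le> enn2real (\<rho> x + \<rho> y)"
      using fin extended_seminorm_add[OF \<rho>] by (intro enn2real_mono) auto
    then show ?thesis using fin by (simp add: enn2real_plus)
  qed
  then show "seminorm (\<lambda>x. enn2real (\<rho> x))"
    by (simp add: seminorm_def extended_seminorm_scale[OF \<rho>] enn2real_mult)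
qed

lemma finite_seminorm_modulus: "functional f \<Longrightarrow> finite_seminorm smul (modulus f)"
  by (rule finite_seminorm_ennreal) (rule seminorm_norm_functional)

text \<open>
  A linear functional is continuous as soon as it is bounded on a neighbourhood of \<open>0\<close>, also for
  extended seminorms: scaling by a positive real acts on their finite values as usual.
\<close>

lemma continuous_functional_iff:
  assumes P: "\<And>\<rho>. \<rho> \<in> P \<Longrightarrow> extended_seminorm smul \<rho>" and f: "functional f"
  shows "continuous_map (induced_topology P) euclidean f \<longleftrightarrow>
    (\<exists>J \<delta>. finite J \<and> J \<subseteq> P \<and> \<delta> > 0 \<and> (\<forall>x\<in>basic_nbhd J \<delta> 0. norm (f x) < 1))"
proof
  assume "continuous_map (induced_topology P) euclidean f"
  then have "openin (induced_topology P) {x \<in> topspace (induced_topology P). f x \<in> ball 0 1}"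
    by (rule openin_continuous_map_preimage) simp
  moreover have "0 \<in> {x \<in> topspace (induced_topology P). f x \<in> ball 0 1}"
    using functional_diff[OF f, of 0 0] by simp
  ultimately obtain J \<delta> where J: "finite J" "J \<subseteq> P" "\<delta> > 0"
    "basic_nbhd J \<delta> 0 \<subseteq> {x \<in> topspace (induced_topology P). f x \<in> ball 0 1}"
    by (rule basic_nbhd_in_openin)
  have "\<forall>x\<in>basic_nbhd J \<delta> 0. norm (f x) < 1" using J(4) by auto
  then show "\<exists>J \<delta>. finite J \<and> J \<subseteq> P \<and> \<delta> > 0 \<and> (\<forall>x\<in>basic_nbhd J \<delta> 0. norm (f x) < 1)"
    using J(1-3) by blast
next
  assume "\<exists>J \<delta>. finite J \<and> J \<subseteq> P \<and> \<delta> > 0 \<and> (\<forall>x\<in>basic_nbhd J \<delta> 0. norm (f x) < 1)"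
  then obtain J \<delta> where J: "finite J" "J \<subseteq> P" "\<delta> > 0"
    and less: "\<And>x. x \<in> basic_nbhd J \<delta> 0 \<Longrightarrow> norm (f x) < 1" by blast
  have "openin (induced_topology P) {x. f x \<in> U}" if U: "open U" for U
    unfolding openin_induced_topology
  proof safe
    fix x assume "f x \<in> U"
    then obtain e where e: "e > 0" "ball (f x) e \<subseteq> U" using U openE by blast
    have "basic_nbhd J (e * \<delta>) x \<subseteq> {x. f x \<in> U}"
    proof
      fix y assume y: "y \<in> basic_nbhd J (e * \<delta>) x"
      have "\<rho> ((1/e) *\<^sub>r (y - x)) < ennreal \<delta>" if "\<rho> \<in> J" for \<rho>
      proof -
        have "\<rho> (y - x) < ennreal (e * \<delta>)" using y that by (simp add: basic_nbhd_def)
        then obtain r where r: "\<rho> (y - x) = ennreal r" "r \<ge> 0" "r < e * \<delta>"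
          by (cases "\<rho> (y - x)") (auto simp: ennreal_less_iff)
        have "extended_seminorm smul \<rho>" using that J(2) P by blast
        then have "\<rho> ((1/e) *\<^sub>r (y - x)) = ennreal (norm (of_real (1/e) :: 'k)) * \<rho> (y - x)"
          by (rule extended_seminorm_scale)
        also have "\<dots> = ennreal (r / e)"
          using r e(1) by (simp add: norm_divide flip: ennreal_mult)
        also have "\<dots> < ennreal \<delta>" using r e(1) by (simp add: ennreal_less_iff field_simps)
        finally show ?thesis .
      qed
      then have "norm (f ((1/e) *\<^sub>r (y - x))) < 1" by (intro less) (simp add: basic_nbhd_def)
      then have "norm (f y - f x) < e"
        using e(1) by (simp add: functional_scale[OF f] functional_diff[OF f] norm_mult norm_divide)
      then show "y \<in> {x. f x \<in> U}" using e(2) by (auto simp: dist_norm norm_minus_commute)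
    qed
    then show "\<exists>J \<epsilon>. finite J \<and> J \<subseteq> P \<and> \<epsilon> > 0 \<and> basic_nbhd J \<epsilon> x \<subseteq> {x. f x \<in> U}"
      using J e(1) by (intro exI[of _ J] exI[of _ "e * \<delta>"]) simp
  qed
  then show "continuous_map (induced_topology P) euclidean f" by (simp add: continuous_map_def)
qed

lemma functional_continuous_dual: "f \<in> continuous_dual smul \<tau> \<Longrightarrow> functional f"
  by (simp add: continuous_dual_def)

lemma locally_convex_weak_topology: "locally_convex_topology smul (weak_topology smul \<tau>)"
proof -
  have "\<forall>\<rho>\<in>modulus ` continuous_dual smul \<tau>. finite_seminorm smul \<rho>"
    by (auto simp: finite_seminorm_modulus functional_continuous_dual)
  then show ?thesis
    unfolding locally_convex_topology_def weak_topology_def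
    by (intro conjI vector_space_axioms exI[of _ "modulus ` continuous_dual smul \<tau>"] refl)
qed

lemma coarser_weak_topology:
  assumes P: "\<And>\<rho>. \<rho> \<in> P \<Longrightarrow> extended_seminorm smul \<rho>"
  shows "coarser (weak_topology smul (induced_topology P)) (induced_topology P)"
  unfolding weak_topology_def
proof (rule coarser_induced_topologyI)
  fix \<rho> :: "'v \<Rightarrow> ennreal" and \<epsilon> :: real
  assume "\<rho> \<in> modulus ` continuous_dual smul (induced_topology P)" and \<epsilon>: "\<epsilon> > 0"
  then obtain f where f: "\<rho> = modulus f" "continuous_map (induced_topology P) euclidean f"
    "functional f" by (auto simp: continuous_dual_def)
  have "openin (induced_topology P) {x \<in> topspace (induced_topology P). f x \<in> ball 0 \<epsilon>}"
    using f(2) by (rule openin_continuous_map_preimage) simp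
  moreover have "{x \<in> topspace (induced_topology P). f x \<in> ball 0 \<epsilon>} = basic_nbhd {\<rho>} \<epsilon> 0"
    using \<epsilon> by (simp add: f(1) basic_nbhd_def ennreal_less_iff)
  moreover have "0 \<in> basic_nbhd {\<rho>} \<epsilon> 0"
    using functional_diff[OF f(3), of 0 0] \<epsilon> by (simp add: f(1) basic_nbhd_def)
  ultimately obtain J \<delta> where J: "finite J" "J \<subseteq> P" "\<delta> > 0" "basic_nbhd J \<delta> 0 \<subseteq> basic_nbhd {\<rho>} \<epsilon> 0"
    using basic_nbhd_in_openin[of P "basic_nbhd {\<rho>} \<epsilon> 0" 0] by auto
  then show "\<exists>J \<delta>. finite J \<and> J \<subseteq> P \<and> \<delta> > 0 \<and> basic_nbhd J \<delta> 0 \<subseteq> basic_nbhd {\<rho>} \<epsilon> 0"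
    by (intro exI[of _ J] exI[of _ \<delta>]) simp
qed

text \<open>
  A seminorm that vanishes on a common kernel is dominated by a multiple of a finite sum of moduli of
  functionals in \<open>D\<close>, so it is small where these moduli are.
\<close>

lemma coarser_modulus_topologyI:
  assumes F: "\<And>\<rho>. \<rho> \<in> P \<Longrightarrow> finite_seminorm smul \<rho>" and D: "\<And>f. f \<in> D \<Longrightarrow> functional f"
    and ker: "\<And>\<rho>. \<rho> \<in> P \<Longrightarrow> \<exists>F. finite F \<and> F \<subseteq> D \<and> (\<forall>x\<in>common_kernel F. \<rho> x = 0)"
  shows "coarser (induced_topology P) (induced_topology (modulus ` D))"
proof (rule coarser_induced_topologyI)
  fix \<rho> and \<epsilon> :: real assume \<rho>: "\<rho> \<in> P" and \<epsilon>: "\<epsilon> > 0"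
  obtain p where p: "seminorm p" "\<rho> = (\<lambda>x. ennreal (p x))"
    using seminorm_enn2real[OF F[OF \<rho>]] by blast
  obtain F where F: "finite F" "F \<subseteq> D" "\<And>x. x \<in> common_kernel F \<Longrightarrow> \<rho> x = 0"
    using ker[OF \<rho>] by blast
  have p0: "p x = 0" if "x \<in> common_kernel F" for x
    using F(3)[OF that] seminorm_nonneg[OF p(1), of x] by (simp add: p(2) ennreal_eq_0_iff)
  have fF: "functional f" if "f \<in> F" for f using that F(2) D by blast
  obtain \<delta> where \<delta>: "\<delta> > 0" "\<And>x. x \<in> basic_nbhd (modulus ` F) \<delta> 0 \<Longrightarrow> p x < \<epsilon>"
    using seminorm_small_near_common_kernel[OF F(1) fF p(1) p0 \<epsilon>] by blast
  have "x \<in> basic_nbhd {\<rho>} \<epsilon> 0" if "x \<in> basic_nbhd (modulus ` F) \<delta> 0" for x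
    unfolding basic_nbhd_def p(2)
    using \<delta>(2)[OF that] by (simp add: ennreal_less_iff seminorm_nonneg[OF p(1)])
  then have "basic_nbhd (modulus ` F) \<delta> 0 \<subseteq> basic_nbhd {\<rho>} \<epsilon> 0" by blast
  then show "\<exists>J \<delta>. finite J \<and> J \<subseteq> modulus ` D \<and> \<delta> > 0 \<and> basic_nbhd J \<delta> 0 \<subseteq> basic_nbhd {\<rho>} \<epsilon> 0"
    using F(1,2) \<delta>(1) by (intro exI[of _ "modulus ` F"] exI[of _ \<delta>]) auto
qed

lemma common_kernel_in_modulus_nbhd:
  assumes "finite J" "J \<subseteq> modulus ` D" "\<delta> > 0"
  obtains F where "finite F" "F \<subseteq> D" "common_kernel F \<subseteq> basic_nbhd J \<delta> 0"
proof -
  obtain F where "F \<subseteq> D" "finite F" "J = modulus ` F"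
    using finite_subset_image[OF assms(1,2)] by blast
  then show thesis using that common_kernel_subset_basic_nbhd[OF assms(3), of F] by blast
qed

section \<open>Metrizability of the weak topology forces the two topologies to agree\<close>

text \<open>
  In the algebraic sense the dual is countably generated: the weak neighbourhoods of \<open>0\<close> in a
  countable base each contain a common kernel, and every functional is bounded on one of them.
\<close>

lemma common_kernels_cofinal_if_metrizable:
  assumes "metrizable_space (induced_topology (modulus ` D))" and D: "\<And>f. f \<in> D \<Longrightarrow> functional f"
  obtains F :: "nat \<Rightarrow> ('v \<Rightarrow> 'k) set"
  where "\<And>n. finite (F n)" "\<And>n. F n \<subseteq> D" "\<And>f. f \<in> D \<Longrightarrow> \<exists>n. \<forall>x\<in>common_kernel (F n). f x = 0"
proof -
  let ?X = "induced_topology (modulus ` D)"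
  have "first_countable ?X" using assms(1) by (rule metrizable_imp_first_countable)
  then obtain B where B: "countable B" "\<And>V. V \<in> B \<Longrightarrow> openin ?X V"
    "\<And>U. openin ?X U \<Longrightarrow> 0 \<in> U \<Longrightarrow> \<exists>V\<in>B. 0 \<in> V \<and> V \<subseteq> U"
    unfolding first_countable_def by (metis UNIV_I topspace_induced_topology)
  \<comment> \<open>A base at \<open>0\<close> may contain sets that miss \<open>0\<close>; these contain no common kernel and are dropped.\<close>
  define B0 where "B0 = {V \<in> B. 0 \<in> V}"
  have "\<exists>F. finite F \<and> F \<subseteq> D \<and> common_kernel F \<subseteq> V" if V: "V \<in> B0" for V
  proof -
    have "openin ?X V" "0 \<in> V" using V B(2) by (auto simp: B0_def)
    then obtain J \<delta> where J: "finite J" "J \<subseteq> modulus ` D" "\<delta> > 0" "basic_nbhd J \<delta> 0 \<subseteq> V"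
      by (rule basic_nbhd_in_openin)
    show ?thesis using common_kernel_in_modulus_nbhd[OF J(1-3)] J(4) by (metis order_trans)
  qed
  then obtain F where F: "\<And>V. V \<in> B0 \<Longrightarrow> finite (F V) \<and> F V \<subseteq> D \<and> common_kernel (F V) \<subseteq> V"
    by metis
  have ne: "B0 \<noteq> {}" using B(3)[of UNIV] openin_topspace[of ?X] by (auto simp: B0_def)
  have cB0: "countable B0" using B(1) by (simp add: B0_def)
  have mem: "from_nat_into B0 n \<in> B0" for n using ne by (rule from_nat_into)
  show thesis
  proof (rule that[of "\<lambda>n. F (from_nat_into B0 n)"])
    fix f assume f: "f \<in> D"
    have "openin ?X (basic_nbhd {modulus f} 1 0)"
      using f finite_seminorm_modulus[OF D[OF f]]
      by (intro openin_basic_nbhd) (auto simp: finite_seminorm_def)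
    moreover have "0 \<in> basic_nbhd {modulus f} 1 0"
      using functional_diff[OF D[OF f], of 0 0] by (simp add: basic_nbhd_def)
    ultimately obtain V where V: "V \<in> B0" "V \<subseteq> basic_nbhd {modulus f} 1 0"
      using B(3) unfolding B0_def by blast
    obtain n where n: "from_nat_into B0 n = V" using from_nat_into_surj[OF cB0 V(1)] by blast
    have "norm (f x) = 0" if "x \<in> common_kernel (F V)" for x
    proof (rule seminorm_zero_on_common_kernel[OF seminorm_norm_functional[OF D[OF f]] _ _ that])
      show "functional g" if "g \<in> F V" for g using that F[OF V(1)] D by blast
      show "norm (f y) < 1" if "y \<in> common_kernel (F V)" for y
        using that F[OF V(1)] V(2) by (auto simp: basic_nbhd_def)
    qed
    then show "\<exists>n. \<forall>x\<in>common_kernel (F (from_nat_into B0 n)). f x = 0"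
      using n by (intro exI[of _ n]) simp
  qed (use F mem in blast)+
qed

text \<open>
  If \<open>p\<close> were nonzero somewhere on each of the kernels, a functional dominated by \<open>p\<close> and nonzero at
  all of these points would be a continuous functional not vanishing on any of the kernels.
\<close>

lemma continuous_seminorm_zero_on_common_kernel:
  assumes P: "\<And>\<rho>. \<rho> \<in> P \<Longrightarrow> extended_seminorm smul \<rho>"
    and F: "\<And>f. f \<in> continuous_dual smul (induced_topology P) \<Longrightarrow> \<exists>n::nat. \<forall>x\<in>common_kernel (F n). f x = 0"
    and p: "seminorm p"
    and J: "finite J" "J \<subseteq> P" "\<delta> > 0" "\<And>x. x \<in> basic_nbhd J \<delta> 0 \<Longrightarrow> p x < 1/2"
  shows "\<exists>n. \<forall>x\<in>common_kernel (F n). p x = 0"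
proof (rule ccontr)
  assume "\<not> ?thesis"
  then have "\<exists>x. x \<in> common_kernel (F n) \<and> p x \<noteq> 0" for n by blast
  then obtain x where x: "\<And>n. x n \<in> common_kernel (F n)" "\<And>n. p (x n) \<noteq> 0" by metis
  have pos: "p (x n) > 0" for n using x(2)[of n] seminorm_nonneg[OF p, of "x n"] by simp
  obtain f where f: "functional f" "\<And>y. norm (f y) \<le> 2 * p y" "\<And>n. f (x n) \<noteq> 0"
    by (rule functional_nonzero_on_sequence[where p = p and x = x]) (use p pos that in auto)
  \<comment> \<open>The bound \<open>1/2\<close> on \<open>p\<close> absorbs the factor \<open>2\<close> in the domination of \<open>f\<close> by \<open>p\<close>.\<close>
  have "norm (f y) < 1" if "y \<in> basic_nbhd J \<delta> 0" for y
    using f(2)[of y] J(4)[OF that] by simp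
  then have "continuous_map (induced_topology P) euclidean f"
    using J(1-3) continuous_functional_iff[OF P f(1)] by blast
  then have "f \<in> continuous_dual smul (induced_topology P)"
    using f(1) by (simp add: continuous_dual_def)
  then show False using F x(1) f(3) by blast
qed

lemma flc_eq_weak_if_metrizable:
  assumes P: "\<And>\<rho>. \<rho> \<in> P \<Longrightarrow> extended_seminorm smul \<rho>"
    and met: "metrizable_space (weak_topology smul (induced_topology P))"
    and flc: "is_flc_topology smul (induced_topology P) \<sigma>"
  shows "\<sigma> = weak_topology smul (induced_topology P)"
proof (rule coarser_antisym)
  let ?D = "continuous_dual smul (induced_topology P)"
  show "coarser (weak_topology smul (induced_topology P)) \<sigma>"
    using flc locally_convex_weak_topology coarser_weak_topology[OF P]
    by (simp add: is_flc_topology_def)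
  obtain S where S: "\<And>\<rho>. \<rho> \<in> S \<Longrightarrow> finite_seminorm smul \<rho>" "\<sigma> = induced_topology S"
    using flc by (auto simp: is_flc_topology_def locally_convex_topology_def)
  have coarser: "coarser (induced_topology S) (induced_topology P)"
    using flc S(2) by (simp add: is_flc_topology_def)
  have dual: "functional f" if "f \<in> ?D" for f using that by (rule functional_continuous_dual)
  obtain F :: "nat \<Rightarrow> ('v \<Rightarrow> 'k) set" where F: "\<And>n. finite (F n)" "\<And>n. F n \<subseteq> ?D"
    "\<And>f. f \<in> ?D \<Longrightarrow> \<exists>n. \<forall>x\<in>common_kernel (F n). f x = 0"
    by (rule common_kernels_cofinal_if_metrizable[OF met[unfolded weak_topology_def] dual])
      (assumption, rule that)
  show "coarser \<sigma> (weak_topology smul (induced_topology P))"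
    unfolding S(2) weak_topology_def
  proof (rule coarser_modulus_topologyI[OF S(1) dual])
    fix \<rho> assume \<rho>: "\<rho> \<in> S"
    obtain p where p: "seminorm p" "\<rho> = (\<lambda>x. ennreal (p x))"
      using seminorm_enn2real[OF S(1)[OF \<rho>]] by blast
    have "extended_seminorm smul \<rho>" using S(1)[OF \<rho>] by (simp add: finite_seminorm_def)
    then obtain J \<delta> where J: "finite J" "J \<subseteq> P" "\<delta> > 0" "basic_nbhd J \<delta> 0 \<subseteq> basic_nbhd {\<rho>} (1/2) 0"
      using coarser_basic_nbhd[OF vector_space_axioms _ \<rho> _ coarser, of "1/2"] by auto
    have "p x < 1/2" if "x \<in> basic_nbhd J \<delta> 0" for x
    proof -
      have "\<rho> (x - 0) < ennreal (1/2)" using J(4) that unfolding basic_nbhd_def by blast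
      then have "ennreal (p x) < ennreal (1/2)" by (simp only: p(2) diff_zero)
      then show ?thesis using ennreal_less_iff[OF seminorm_nonneg[OF p(1), of x], of "1/2"] by blast
    qed
    then obtain n where "\<forall>x\<in>common_kernel (F n). p x = 0"
      using continuous_seminorm_zero_on_common_kernel[OF P F(3) p(1) J(1-3)] by blast
    then show "\<exists>G. finite G \<and> G \<subseteq> ?D \<and> (\<forall>x\<in>common_kernel G. \<rho> x = 0)"
      using F(1,2) by (intro exI[of _ "F n"]) (simp add: p(2))
  qed
qed

section \<open>Agreement of the two topologies forces metrizability\<close>

text \<open>
  The sum of the absolute values of the coordinates with respect to a Hamel basis.
\<close>

lemma ell1_norm_exists:
  obtains s where "seminorm s" "\<And>x. s x = 0 \<Longrightarrow> x = 0"
proof -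
  obtain B where B: "independent B" "span B = UNIV"
    using maximal_independent_subset[of UNIV] by (metis top.extremum_uniqueI)
  let ?r = "representation B"
  define s where "s x = (\<Sum>b | ?r x b \<noteq> 0. norm (?r x b))" for x
  have s_eq: "s x = (\<Sum>b\<in>C. norm (?r x b))" if "finite C" "{b. ?r x b \<noteq> 0} \<subseteq> C" for x C
    unfolding s_def by (rule sum.mono_neutral_left) (use that in auto)
  have fin: "finite {b. ?r x b \<noteq> 0}" for x by (rule finite_representation)
  have add: "?r (x + y) b = ?r x b + ?r y b" for x y b
    using B by (simp add: representation_add)
  have scale: "?r (a *\<^sub>K x) b = a * ?r x b" for a x b
    using B by (simp add: representation_scale)
  have "seminorm s"
    unfolding seminorm_def
  proof (intro conjI allI)
    fix a x
    have "s (a *\<^sub>K x) = (\<Sum>b | ?r x b \<noteq> 0. norm (?r (a *\<^sub>K x) b))"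
      by (rule s_eq) (auto simp: fin scale)
    then show "s (a *\<^sub>K x) = norm a * s x"
      by (simp add: s_def scale norm_mult sum_distrib_left)
  next
    fix x y
    let ?C = "{b. ?r x b \<noteq> 0} \<union> {b. ?r y b \<noteq> 0}"
    have "s (x + y) = (\<Sum>b\<in>?C. norm (?r (x + y) b))"
      by (rule s_eq) (auto simp: fin add)
    also have "\<dots> \<le> (\<Sum>b\<in>?C. norm (?r x b) + norm (?r y b))"
      by (intro sum_mono) (simp add: add norm_triangle_ineq)
    also have "\<dots> = s x + s y"
      using s_eq[of ?C x] s_eq[of ?C y] fin by (simp add: sum.distrib)
    finally show "s (x + y) \<le> s x + s y" .
  qed
  moreover have "x = 0" if "s x = 0" for x
  proof -
    have "?r x b = 0" for b
      using that fin[of x] by (cases "?r x b = 0") (auto simp: s_def sum_nonneg_eq_0_iff)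
    moreover have "(\<Sum>b | ?r x b \<noteq> 0. ?r x b *\<^sub>K b) = x"
      using B by (intro sum_nonzero_representation_eq) auto
    ultimately show ?thesis by simp
  qed
  ultimately show thesis by (rule that)
qed

text \<open>
  Let \<open>\<pi>\<close> be a linear projection onto the subspace where \<open>\<sigma>\<close> is finite and \<open>s\<close> a norm on the whole
  space. Then \<open>q x = \<sigma> (\<pi> x) + s (x - \<pi> x)\<close> works: it equals \<open>\<sigma>\<close> where \<open>\<sigma>\<close> is finite, and off this
  subspace there is nothing to prove for \<open>q \<le> \<sigma>\<close> while the second summand keeps \<open>q\<close> nonzero.
\<close>

proposition finite_seminorm_below_with_same_zeros:
  assumes \<sigma>: "extended_seminorm smul \<sigma>"
  obtains q where "seminorm q" "\<And>x. ennreal (q x) \<le> \<sigma> x" "\<And>x. q x = 0 \<Longrightarrow> \<sigma> x = 0"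
proof -
  note sc = extended_seminorm_scale[OF \<sigma>] and ad = extended_seminorm_add[OF \<sigma>]
  let ?V = "{x. \<sigma> x < top}"
  have V: "subspace ?V"
  proof (rule subspaceI)
    show "0 \<in> ?V" using extended_seminorm_zero[OF vector_space_axioms \<sigma>] by simp
    show "x + y \<in> ?V" if "x \<in> ?V" "y \<in> ?V" for x y
      using that ad[of x y] by (auto intro: le_less_trans)
    show "a *\<^sub>K x \<in> ?V" if "x \<in> ?V" for a x
      using that by (simp add: sc ennreal_mult_less_top)
  qed
  interpret pair: vector_space_pair smul smul by unfold_locales
  obtain \<pi> where \<pi>: "range \<pi> \<subseteq> ?V" "Vector_Spaces.linear smul smul \<pi>" "\<And>x. x \<in> ?V \<Longrightarrow> \<pi> x = x"
    using pair.linear_exists_left_inverse_on[OF linear_id V] by auto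
  have \<pi>_fin: "\<sigma> (\<pi> x) < top" for x using \<pi>(1) by auto
  have \<pi>_add: "\<pi> (x + y) = \<pi> x + \<pi> y" and \<pi>_scale: "\<pi> (a *\<^sub>K x) = a *\<^sub>K \<pi> x" for a x y
    using \<pi>(2) by (simp_all add: Vector_Spaces.linear_iff)
  obtain s where s: "seminorm s" "\<And>x. s x = 0 \<Longrightarrow> x = 0" using ell1_norm_exists by blast
  define q where "q x = enn2real (\<sigma> (\<pi> x)) + s (x - \<pi> x)" for x
  show thesis
  proof (rule that)
    show "seminorm q"
      unfolding seminorm_def
    proof (intro conjI allI)
      fix a x
      have "a *\<^sub>K x - \<pi> (a *\<^sub>K x) = a *\<^sub>K (x - \<pi> x)"
        by (simp add: \<pi>_scale scale_right_diff_distrib)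
      then show "q (a *\<^sub>K x) = norm a * q x"
        by (simp add: q_def \<pi>_scale sc seminorm_scale[OF s(1)] enn2real_mult distrib_left)
    next
      fix x y
      have "x + y - \<pi> (x + y) = (x - \<pi> x) + (y - \<pi> y)" by (simp add: \<pi>_add)
      then have "s (x + y - \<pi> (x + y)) \<le> s (x - \<pi> x) + s (y - \<pi> y)"
        using seminorm_add[OF s(1)] by (simp only:)
      moreover have "enn2real (\<sigma> (\<pi> (x + y))) \<le> enn2real (\<sigma> (\<pi> x) + \<sigma> (\<pi> y))"
        unfolding \<pi>_add using ad \<pi>_fin by (intro enn2real_mono) auto
      moreover have "\<dots> = enn2real (\<sigma> (\<pi> x)) + enn2real (\<sigma> (\<pi> y))"
        using \<pi>_fin by (simp add: enn2real_plus)
      ultimately show "q (x + y) \<le> q x + q y" by (simp add: q_def)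
    qed
    show "ennreal (q x) \<le> \<sigma> x" for x
    proof (cases "\<sigma> x < top")
      case True
      then show ?thesis using \<pi>(3)[of x] seminorm_zero[OF s(1)] by (simp add: q_def)
    next
      case False
      then show ?thesis by (simp add: less_top[symmetric])
    qed
    fix x assume "q x = 0"
    then have "enn2real (\<sigma> (\<pi> x)) = 0" "s (x - \<pi> x) = 0"
      using seminorm_nonneg[OF s(1), of "x - \<pi> x"] enn2real_nonneg[of "\<sigma> (\<pi> x)"]
      unfolding q_def by linarith+
    then show "\<sigma> x = 0"
      using s(2)[of "x - \<pi> x"] \<pi>_fin[of x] by (auto simp: enn2real_eq_0_iff)
  qed
qed

text \<open>
  The finite seminorm below the supremum of \<open>J\<close> induces a locally convex topology coarser than the
  given one, hence coarser than the weak topology; so this seminorm is bounded on some common kernel,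
  and therefore zero there.
\<close>

lemma common_kernel_in_zeros_if_flc_eq_weak:
  assumes P: "\<And>\<rho>. \<rho> \<in> P \<Longrightarrow> extended_seminorm smul \<rho>"
    and flc: "is_flc_topology smul (induced_topology P) (weak_topology smul (induced_topology P))"
    and J: "finite J" "J \<subseteq> P"
  shows "\<exists>F. finite F \<and> F \<subseteq> continuous_dual smul (induced_topology P) \<and>
    (\<forall>x\<in>common_kernel F. \<forall>\<rho>\<in>J. \<rho> x = 0)"
proof -
  let ?D = "continuous_dual smul (induced_topology P)"
  define \<sigma> where "\<sigma> = (\<lambda>x. SUP \<rho>\<in>J. \<rho> x)"
  have "extended_seminorm smul \<sigma>"
    unfolding \<sigma>_def by (rule extended_seminorm_SUP) (use J(2) P in blast)
  then obtain q where q: "seminorm q" "\<And>x. ennreal (q x) \<le> \<sigma> x" "\<And>x. q x = 0 \<Longrightarrow> \<sigma> x = 0"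
    using finite_seminorm_below_with_same_zeros by blast
  let ?q = "\<lambda>x. ennreal (q x)"
  have fin: "finite_seminorm smul ?q" using q(1) by (rule finite_seminorm_ennreal)
  have "coarser (induced_topology {?q}) (induced_topology P)"
  proof (rule coarser_induced_topologyI)
    fix \<rho> :: "'v \<Rightarrow> ennreal" and \<epsilon> :: real assume \<rho>: "\<rho> \<in> {?q}" and \<epsilon>: "\<epsilon> > 0"
    have "x \<in> basic_nbhd {\<rho>} \<epsilon> 0" if "x \<in> basic_nbhd J (\<epsilon>/2) 0" for x
    proof -
      have "\<sigma> x \<le> ennreal (\<epsilon>/2)"
        unfolding \<sigma>_def using that by (intro SUP_least) (auto simp: basic_nbhd_def intro: less_imp_le)
      also have "\<dots> < ennreal \<epsilon>" using \<epsilon> by (simp add: ennreal_less_iff)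
      finally have "?q x < ennreal \<epsilon>" using q(2) by (rule le_less_trans[rotated])
      then show ?thesis using \<rho> by (simp add: basic_nbhd_def)
    qed
    then have "basic_nbhd J (\<epsilon>/2) 0 \<subseteq> basic_nbhd {\<rho>} \<epsilon> 0" by blast
    then show "\<exists>J \<delta>. finite J \<and> J \<subseteq> P \<and> \<delta> > 0 \<and> basic_nbhd J \<delta> 0 \<subseteq> basic_nbhd {\<rho>} \<epsilon> 0"
      using J \<epsilon> by (intro exI[of _ J] exI[of _ "\<epsilon>/2"]) simp
  qed
  moreover have "locally_convex_topology smul (induced_topology {?q})"
    unfolding locally_convex_topology_def using fin
    by (intro conjI vector_space_axioms exI[of _ "{?q}"]) auto
  ultimately have "coarser (induced_topology {?q}) (induced_topology (modulus ` ?D))"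
    using flc by (simp add: is_flc_topology_def weak_topology_def)
  then obtain K \<delta> where K: "finite K" "K \<subseteq> modulus ` ?D" "\<delta> > 0"
    "basic_nbhd K \<delta> 0 \<subseteq> basic_nbhd {?q} 1 0"
    using coarser_basic_nbhd[OF vector_space_axioms, of ?q "{?q}" 1 "modulus ` ?D"] fin
    by (auto simp: finite_seminorm_def)
  obtain F where F: "finite F" "F \<subseteq> ?D" "common_kernel F \<subseteq> basic_nbhd K \<delta> 0"
    using common_kernel_in_modulus_nbhd[OF K(1-3)] by blast
  have "q x = 0" if "x \<in> common_kernel F" for x
  proof (rule seminorm_zero_on_common_kernel[OF q(1) _ _ that])
    show "functional f" if "f \<in> F" for f using that F(2) functional_continuous_dual by blast
    show "q y < 1" if "y \<in> common_kernel F" for y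
    proof -
      have "y \<in> basic_nbhd {?q} 1 0" using that F(3) K(4) by blast
      then show ?thesis by (simp add: basic_nbhd_def)
    qed
  qed
  then have "\<sigma> x = 0" if "x \<in> common_kernel F" for x using that q(3) by blast
  then have "\<rho> x = 0" if "x \<in> common_kernel F" "\<rho> \<in> J" for x \<rho>
    using SUP_upper[OF that(2), of "\<lambda>\<rho>. \<rho> x"] that(1) by (simp add: \<sigma>_def)
  then show ?thesis using F(1,2) by blast
qed

text \<open>
  There are only countably many finite subsets of \<open>P\<close>, and each contributes finitely many functionals;
  together they separate points and induce the weak topology.
\<close>

lemma metrizable_if_flc_eq_weak:
  assumes P: "\<And>\<rho>. \<rho> \<in> P \<Longrightarrow> extended_seminorm smul \<rho>" and count: "countable P"
    and haus: "Hausdorff_space (induced_topology P)"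
    and flc: "is_flc_topology smul (induced_topology P) (weak_topology smul (induced_topology P))"
  shows "metrizable_space (weak_topology smul (induced_topology P))"
proof -
  let ?D = "continuous_dual smul (induced_topology P)"
  let ?J = "{J. finite J \<and> J \<subseteq> P}"
  have "\<forall>J\<in>?J. \<exists>F. finite F \<and> F \<subseteq> ?D \<and> (\<forall>x\<in>common_kernel F. \<forall>\<rho>\<in>J. \<rho> x = 0)"
    using common_kernel_in_zeros_if_flc_eq_weak[OF P flc] by simp
  from bchoice[OF this] obtain F where "\<forall>J\<in>?J.
      finite (F J) \<and> F J \<subseteq> ?D \<and> (\<forall>x\<in>common_kernel (F J). \<forall>\<rho>\<in>J. \<rho> x = 0)" ..
  note F = bspec[OF this]
  define G where "G = (\<Union>J\<in>?J. F J)"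
  have "countable ?J"
    using countable_Collect_finite_subset[OF count] by (simp add: conj_commute)
  then have G: "countable G"
    unfolding G_def using F by (intro countable_UN) (auto intro: countable_finite)
  have GD: "G \<subseteq> ?D" using F unfolding G_def by blast
  have dual: "functional f" if "f \<in> ?D" for f using that by (rule functional_continuous_dual)
  have in_nbhd: "common_kernel (F J) \<subseteq> basic_nbhd J \<delta> 0" if "J \<in> ?J" "\<delta> > 0" for J \<delta>
  proof
    fix x assume x: "x \<in> common_kernel (F J)"
    have "\<rho> x < ennreal \<delta>" if "\<rho> \<in> J" for \<rho>
    proof -
      have "\<rho> x = 0" using F[OF \<open>J \<in> ?J\<close>] x that by blast
      then show ?thesis using \<open>\<delta> > 0\<close> by simp
    qed
    then show "x \<in> basic_nbhd J \<delta> 0" by (simp add: basic_nbhd_def)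
  qed
  have sep: "\<exists>g\<in>G. g x \<noteq> 0" if nz: "x \<noteq> 0" for x
  proof -
    obtain U V where UV: "openin (induced_topology P) U" "0 \<in> U" "x \<in> V" "disjnt U V"
      using haus[unfolded Hausdorff_space_def, rule_format, of 0 x] nz by auto
    obtain J \<delta> where J: "finite J" "J \<subseteq> P" "\<delta> > 0" "basic_nbhd J \<delta> 0 \<subseteq> U"
      using basic_nbhd_in_openin[OF UV(1,2)] by blast
    have JJ: "J \<in> ?J" using J by simp
    have "x \<notin> common_kernel (F J)"
      using in_nbhd[OF JJ J(3)] J(4) UV(3,4) by (auto simp: disjnt_def)
    then show ?thesis using JJ by (auto simp: common_kernel_def G_def)
  qed
  have "coarser (induced_topology (modulus ` ?D)) (induced_topology (modulus ` G))"
  proof (rule coarser_modulus_topologyI)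
    fix \<rho> :: "'v \<Rightarrow> ennreal" assume "\<rho> \<in> modulus ` ?D"
    then obtain f where f: "\<rho> = modulus f" "f \<in> ?D" by blast
    note lin = dual[OF f(2)]
    obtain J \<delta> where J: "finite J" "J \<subseteq> P" "\<delta> > 0" "\<And>x. x \<in> basic_nbhd J \<delta> 0 \<Longrightarrow> norm (f x) < 1"
      using f(2) continuous_functional_iff[OF P lin] by (auto simp: continuous_dual_def)
    have JJ: "J \<in> ?J" using J by simp
    have "norm (f x) = 0" if "x \<in> common_kernel (F J)" for x
    proof (rule seminorm_zero_on_common_kernel[OF seminorm_norm_functional[OF lin] _ _ that])
      show "functional g" if "g \<in> F J" for g using that F[OF JJ] dual by blast
      show "norm (f y) < 1" if "y \<in> common_kernel (F J)" for y
        using that in_nbhd[OF JJ J(3)] J(4) by blast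
    qed
    then have "\<forall>x\<in>common_kernel (F J). \<rho> x = 0" by (simp add: f(1))
    moreover have "F J \<subseteq> G" using JJ unfolding G_def by blast
    ultimately show "\<exists>H. finite H \<and> H \<subseteq> G \<and> (\<forall>x\<in>common_kernel H. \<rho> x = 0)"
      using F[OF JJ] by (intro exI[of _ "F J"]) simp
  next
    show "finite_seminorm smul \<rho>" if "\<rho> \<in> modulus ` ?D" for \<rho>
      using that dual finite_seminorm_modulus by auto
    show "functional g" if "g \<in> G" for g using that GD dual by blast
  qed
  moreover have "coarser (induced_topology (modulus ` G)) (induced_topology (modulus ` ?D))"
  proof (rule coarser_induced_topologyI)
    fix \<rho> :: "'v \<Rightarrow> ennreal" and \<epsilon> :: real assume "\<rho> \<in> modulus ` G" "\<epsilon> > 0"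
    then show "\<exists>J \<delta>. finite J \<and> J \<subseteq> modulus ` ?D \<and> \<delta> > 0 \<and> basic_nbhd J \<delta> 0 \<subseteq> basic_nbhd {\<rho>} \<epsilon> 0"
      using GD by (intro exI[of _ "{\<rho>}"] exI[of _ \<epsilon>]) auto
  qed
  ultimately have "weak_topology smul (induced_topology P) = induced_topology (modulus ` G)"
    unfolding weak_topology_def by (rule coarser_antisym)
  moreover have "metrizable_space (induced_topology (modulus ` G))"
  proof (rule metrizable_induced_topology_modulus[OF G _ sep])
    show "g (x - y) = g x - g y" if "g \<in> G" for g x y
      using that GD dual functional_diff by blast
  qed
  ultimately show ?thesis by simp
qed

end

theorem theorem3p5:
  fixes smul :: "'k::{real_normed_field, euclidean_space} \<Rightarrow> 'v::ab_group_add \<Rightarrow> 'v"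
    and \<tau> :: "'v topology"
  assumes "elcs smul \<tau>"
  shows "(metrizable_space (weak_topology smul \<tau>) \<longrightarrow>
            flc_topology smul \<tau> = weak_topology smul \<tau>) \<and>
         (countable_elcs smul \<tau> \<and> Hausdorff_space \<tau> \<and>
            flc_topology smul \<tau> = weak_topology smul \<tau> \<longrightarrow>
            metrizable_space (weak_topology smul \<tau>))"
proof -
  interpret euclidean_field_vector_space smul
    using assms by (simp add: elcs_def euclidean_field_vector_space_def)
  note flc = is_flc_topology_flc_topology[OF assms]
  show ?thesis
  proof (intro conjI impI)
    assume met: "metrizable_space (weak_topology smul \<tau>)"
    obtain P where P: "\<And>\<rho>. \<rho> \<in> P \<Longrightarrow> extended_seminorm smul \<rho>" "\<tau> = induced_topology P"
      using assms by (auto simp: elcs_def)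
    show "flc_topology smul \<tau> = weak_topology smul \<tau>"
      using flc_eq_weak_if_metrizable[OF P(1) met[unfolded P(2)] flc[unfolded P(2)]]
      by (simp add: P(2))
  next
    assume "countable_elcs smul \<tau> \<and> Hausdorff_space \<tau> \<and> flc_topology smul \<tau> = weak_topology smul \<tau>"
    then obtain P where P: "\<And>\<rho>. \<rho> \<in> P \<Longrightarrow> extended_seminorm smul \<rho>" "\<tau> = induced_topology P"
      "countable P" and haus: "Hausdorff_space \<tau>" and eq: "flc_topology smul \<tau> = weak_topology smul \<tau>"
      by (auto simp: countable_elcs_def)
    show "metrizable_space (weak_topology smul \<tau>)"
      using metrizable_if_flc_eq_weak[OF P(1,3) haus[unfolded P(2)] flc[unfolded eq, unfolded P(2)]]
      by (simp add: P(2))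
  qed
qed

end
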